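(* Let $G$ be a connected graph of order $n\ge 2$ with no two distinct vertices $x,y$ satisfying $N[x]=N[y]$, and let $\mathcal{H}=\{P_{q_1},\ldots,P_{q_r},C_{q_{r+1}},\ldots,C_{q_n}\}$, where $q_i\ge 4$ for $1\le i\le r$ and $q_i\ge 5$ for $r+1\le i\le n$; let $\overline{\mathcal{H}}$ be the family of complements of the graphs in $\mathcal{H}$. Then (i) $\dim_2(G\circ\overline{\mathcal{H}})=\sum_{i=1}^r\lceil\frac{q_i+1}{2}\rceil+\sum_{i=r+1}^n\lceil\frac{q_i}{2}\rceil$; (ii) $\dim_3(G\circ\overline{\mathcal{H}})=\sum_{i=1}^r\left(q_i-\lfloor\frac{q_i-4}{5}\rfloor\right)+\sum_{i=r+1}^n\left(q_i-\lfloor\frac{q_i}{5}\rfloor\right)$. Moreover, if $G$ is any connected graph of order $n\ge 2$ and $\mathcal{H}=\{C_{q_1},\ldots,C_{q_n}\}$ with all $q_i\ge 5$, then $\dim_4(G\circ\overline{\mathcal{H}})=\sum_{i=1}^n q_i$.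
   Context: $P_q$ and $C_q$ are the path and cycle of order $q$; $N[x]$ is the closed neighborhood. With $V(G)=\{u_1,\ldots,u_n\}$ and a family $\mathcal{F}=\{F_1,\ldots,F_n\}$ (listed in the given order, $F_i$ attached to $u_i$), the lexicographic product $G\circ\mathcal{F}$ has vertex set $\bigcup_i\{u_i\}\times V(F_i)$, with $(u_i,v)\sim(u_j,w)$ iff $u_iu_j\in E(G)$, or $i=j$ and $vw\in E(F_i)$. For a connected graph $X$, $\dim_k(X)$ is the minimum size of $S\subseteq V(X)$ such that every two distinct vertices $x,y$ admit at least $k$ vertices $w\in S$ with $d_X(x,w)\neq d_X(y,w)$. *)

theory Defs
  imports "Graph_Theory.Graph_Theory"
begin

text \<open>
  Finite simple graphs are the library's \<^locale>\<open>pair_graph\<close>s: finite loop-free digraphs with a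
  symmetric arc relation, so that the edge \<open>uv\<close> is represented by the two arcs \<open>(u, v)\<close>
  and \<open>(v, u)\<close>.
\<close>

definition path_graph :: "nat \<Rightarrow> nat pair_pre_digraph" where
  "path_graph q = \<lparr> pverts = {0..<q},
     parcs = {(a, b). a < q \<and> b < q \<and> (b = Suc a \<or> a = Suc b)} \<rparr>"

text \<open>This is the cycle of order \<open>q\<close> only for \<open>q \<ge> 3\<close>; smaller \<open>q\<close> give degenerate graphs.\<close>

definition cycle_graph :: "nat \<Rightarrow> nat pair_pre_digraph" where
  "cycle_graph q = \<lparr> pverts = {0..<q},
     parcs = {(a, b). a < q \<and> b < q \<and> (b = Suc a mod q \<or> a = Suc b mod q)} \<rparr>"

definition complement_graph :: "'a pair_pre_digraph \<Rightarrow> 'a pair_pre_digraph" where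
  "complement_graph G = \<lparr> pverts = pverts G,
     parcs = {(a, b). a \<in> pverts G \<and> b \<in> pverts G \<and> a \<noteq> b \<and> (a, b) \<notin> parcs G} \<rparr>"

definition closed_nbhd :: "'a pair_pre_digraph \<Rightarrow> 'a \<Rightarrow> 'a set" where
  "closed_nbhd G x = insert x {y. (x, y) \<in> parcs G}"

text \<open>
  Lexicographic product of \<open>G\<close>, whose vertices are listed without repetition as
  \<open>u 1, \<dots>, u n\<close>, with the family \<open>F 1, \<dots>, F n\<close>.
\<close>

definition lex_product ::
  "'a pair_pre_digraph \<Rightarrow> nat \<Rightarrow> (nat \<Rightarrow> 'a) \<Rightarrow> (nat \<Rightarrow> 'b pair_pre_digraph) \<Rightarrow> ('a \<times> 'b) pair_pre_digraph"
where
  "lex_product G n u F = \<lparr>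
     pverts = (\<Union>i\<in>{1..n}. {u i} \<times> pverts (F i)),
     parcs = {((u i, v), (u j, w)) | i j v w.
       i \<in> {1..n} \<and> j \<in> {1..n} \<and> v \<in> pverts (F i) \<and> w \<in> pverts (F j) \<and>
       ((u i, u j) \<in> parcs G \<or> i = j \<and> (v, w) \<in> parcs (F i))} \<rparr>"

definition graph_dist :: "'a pair_pre_digraph \<Rightarrow> 'a \<Rightarrow> 'a \<Rightarrow> ereal" where
  "graph_dist X = wf_digraph.\<mu> (with_proj X) (\<lambda>_. 1)"

definition metric_generator :: "nat \<Rightarrow> 'a pair_pre_digraph \<Rightarrow> 'a set \<Rightarrow> bool" where
  "metric_generator k X S \<longleftrightarrow> S \<subseteq> pverts X \<and>
     (\<forall>x\<in>pverts X. \<forall>y\<in>pverts X. x \<noteq> y \<longrightarrow>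
        k \<le> card {w \<in> S. graph_dist X x w \<noteq> graph_dist X y w})"

text \<open>
  Meaningful for finite graphs possessing such a generator; otherwise the value is unspecified.
\<close>

definition metric_dim :: "nat \<Rightarrow> 'a pair_pre_digraph \<Rightarrow> nat" where
  "metric_dim k X = (LEAST m. \<exists>S. metric_generator k X S \<and> card S = m)"

end

theory Submission
  imports Defs
begin

text \<open>
  Inside a copy of \<open>V(F\<^sub>i)\<close>, the distance between distinct vertices is 1 or 2 according to
  adjacency in \<open>F\<^sub>i\<close>, and vertices of the same copy have equal distances to everything outside
  it. Hence a set is a \<open>k\<close>-metric generator only if each of its slices resolves every pair of
  vertices of \<open>F\<^sub>i\<close> by adjacency, \<open>k\<close> times over; a minimum choice of slices also resolves
  pairs from different copies. Adjacency resolving sets do not change under complementation, so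
  the problem reduces to paths and cycles. There \<open>v, v + 1\<close> are resolved by
  \<open>{v - 1, \<dots>, v + 2}\<close> and \<open>v, v + 2\<close> by \<open>{v - 1, v, v + 2, v + 3}\<close>, as far as these vertices
  exist. For \<open>k = 2\<close> it suffices to choose a vertex cover, containing both ends of a path. For
  \<open>k = 3\<close> the omitted vertices have pairwise distance at least 5 and are not among the four first
  or last vertices of a path. For \<open>k = 4\<close> nothing can be omitted. The lower bounds come from
  counting in windows of 4 or 5 consecutive vertices.
\<close>

section \<open>Distances\<close>

text \<open>Powers of the arc relation replace walks in what follows. The conjunct
  \<open>x \<in> pverts X\<close> matters for \<open>m = 0\<close>, where
  \<open>parcs X ^^ 0\<close> relates every element of the type to itself.\<close>

lemma awalk_length_iff_relpow:
  assumes "pair_wf_digraph X"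
  shows "(\<exists>p. pre_digraph.awalk (with_proj X) x p y \<and> length p = m) \<longleftrightarrow>
    x \<in> pverts X \<and> (x, y) \<in> parcs X ^^ m"
proof -
  interpret pair_wf_digraph X by fact
  show ?thesis
  proof (induction m arbitrary: x)
    case 0
    then show ?case by (auto simp: awalk_Nil_iff)
  next
    case (Suc m)
    have "(\<exists>p. awalk x p y \<and> length p = Suc m) \<longleftrightarrow>
      (\<exists>z. (x, z) \<in> parcs X \<and> (\<exists>p. awalk z p y \<and> length p = m))"
    proof (intro iffI; elim exE conjE)
      fix p assume "awalk x p y" "length p = Suc m"
      then show "\<exists>z. (x, z) \<in> parcs X \<and> (\<exists>p. awalk z p y \<and> length p = m)"
        by (cases p) (auto simp: awalk_Cons_iff intro!: exI)
    next
      fix z p assume "(x, z) \<in> parcs X" "awalk z p y" "length p = m"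
      then show "\<exists>p. awalk x p y \<and> length p = Suc m"
        by (intro exI[of _ "(x, z) # p"]) (auto simp: awalk_Cons_iff)
    qed
    also have "\<dots> \<longleftrightarrow> x \<in> pverts X \<and> (x, y) \<in> parcs X ^^ Suc m"
      unfolding Suc.IH using in_arcsD1 in_arcsD2
      by (blast intro: relpow_Suc_I2 dest: relpow_Suc_D2)
    finally show ?case .
  qed
qed

lemma graph_dist_eq_INF_relpow:
  assumes "pair_wf_digraph X" "x \<in> pverts X"
  shows "graph_dist X x y = (INF m\<in>{m. (x, y) \<in> parcs X ^^ m}. ereal (real m))"
proof -
  interpret pair_wf_digraph X by fact
  have cost: "awalk_cost (\<lambda>_. 1) p = real (length p)" for p :: "('a \<times> 'a) list"
    by (induction p) auto
  have "(\<lambda>p. ereal (awalk_cost (\<lambda>_. 1) p)) ` {p. awalk x p y} =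
      (\<lambda>m. ereal (real m)) ` {m. (x, y) \<in> parcs X ^^ m}"
    using awalk_length_iff_relpow[OF assms(1), of x y] assms(2)
    unfolding cost by (auto simp: image_iff) metis+
  then show ?thesis
    unfolding graph_dist_def \<mu>_def by simp
qed

lemma graph_dist_eqI:
  assumes "pair_wf_digraph X" "x \<in> pverts X" "(x, y) \<in> parcs X ^^ m"
    and "\<And>k. k < m \<Longrightarrow> (x, y) \<notin> parcs X ^^ k"
  shows "graph_dist X x y = ereal (real m)"
  unfolding graph_dist_eq_INF_relpow[OF assms(1,2)]
proof (rule antisym)
  show "(INF m\<in>{m. (x, y) \<in> parcs X ^^ m}. ereal (real m)) \<le> ereal (real m)"
    using assms(3) by (auto intro: INF_lower)
  show "ereal (real m) \<le> (INF m\<in>{m. (x, y) \<in> parcs X ^^ m}. ereal (real m))"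
    using assms(4) by (force intro!: INF_greatest simp: not_less[symmetric])
qed

lemma graph_dist_eqD:
  assumes "pair_wf_digraph X" "x \<in> pverts X" "graph_dist X x y = ereal (real m)"
  shows "(x, y) \<in> parcs X ^^ m"
proof -
  let ?M = "{k. (x, y) \<in> parcs X ^^ k}"
  show ?thesis
  proof (cases "?M = {}")
    \<comment> \<open>Without any walk the infimum is over the empty set, hence infinite, and cannot
      be a real number.\<close>
    case True
    then show ?thesis
      using assms(3) unfolding graph_dist_eq_INF_relpow[OF assms(1,2)] True
      by (simp add: top_ereal_def)
  next
    case False
    define l where "l = (LEAST k. (x, y) \<in> parcs X ^^ k)"
    have l: "(x, y) \<in> parcs X ^^ l"
      using False LeastI_ex unfolding l_def by (metis (mono_tags) Collect_empty_eq)
    have "graph_dist X x y = ereal (real l)"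
      using l by (intro graph_dist_eqI assms) (auto simp: l_def dest: not_less_Least)
    then show ?thesis
      using l assms(3) by simp
  qed
qed

lemma graph_dist_eq_0_iff:
  assumes "pair_wf_digraph X" "x \<in> pverts X"
  shows "graph_dist X x y = 0 \<longleftrightarrow> x = y"
  using graph_dist_eqI[OF assms, of y 0] graph_dist_eqD[OF assms, of y 0] by (auto simp: zero_ereal_def)

lemma graph_dist_eq_1_iff:
  assumes "pair_wf_digraph X" "x \<in> pverts X" "x \<noteq> y"
  shows "graph_dist X x y = 1 \<longleftrightarrow> (x, y) \<in> parcs X"
  using graph_dist_eqI[OF assms(1,2), of y 1] graph_dist_eqD[OF assms(1,2), of y 1] assms(3)
  by (auto simp: one_ereal_def)

lemma graph_dist_eq_2I:
  assumes "pair_wf_digraph X" "(x, z) \<in> parcs X" "(z, y) \<in> parcs X" "(x, y) \<notin> parcs X" "x \<noteq> y"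
  shows "graph_dist X x y = 2"
proof -
  interpret pair_wf_digraph X by fact
  have "graph_dist X x y = ereal (real 2)"
  proof (rule graph_dist_eqI)
    show "(x, y) \<in> parcs X ^^ 2"
      using assms(2,3) by (auto simp: numeral_2_eq_2)
    show "(x, y) \<notin> parcs X ^^ k" if "k < 2" for k
      using that assms(4,5) by (auto simp: less_2_cases_iff)
  qed (use assms in_arcsD1 in auto)
  then show ?thesis by simp
qed

text \<open>The slack \<open>k \<le> m\<close> leaves room for discarding an initial piece of a
  walk, as happens in \<open>relpow_swap_start\<close>.\<close>

lemma graph_dist_cong:
  assumes "pair_wf_digraph X" "x \<in> pverts X" "x' \<in> pverts X"
    and "\<And>m. (x, y) \<in> parcs X ^^ m \<Longrightarrow> \<exists>k\<le>m. (x', y) \<in> parcs X ^^ k"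
    and "\<And>m. (x', y) \<in> parcs X ^^ m \<Longrightarrow> \<exists>k\<le>m. (x, y) \<in> parcs X ^^ k"
  shows "graph_dist X x y = graph_dist X x' y"
  unfolding graph_dist_eq_INF_relpow[OF assms(1,2)] graph_dist_eq_INF_relpow[OF assms(1,3)]
  by (rule antisym; rule INF_mono) (use assms(4,5) in auto)

lemma connected_has_neighbour:
  assumes "pair_graph G" "connected (with_proj G)" "x \<in> pverts G" "card (pverts G) \<ge> 2"
  obtains y where "(x, y) \<in> parcs G"
proof -
  interpret pair_graph G by fact
  have "pverts G \<noteq> {x}"
    using assms(4) by auto
  then obtain z where z: "z \<in> pverts G" "z \<noteq> x"
    using assms(3) by blast
  have "x \<rightarrow>\<^sup>*\<^bsub>with_proj (mk_symmetric (with_proj G))\<^esub> z"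
    using assms(2,3) z unfolding connected_def by auto
  then have "(x, z) \<in> (parcs (mk_symmetric (with_proj G)))\<^sup>*"
    by (metis reachable_rtranclI with_proj_simps(3))
  \<comment> \<open>\<open>connected\<close> refers to the symmetric closure, which adds nothing to
    an arc relation that is already symmetric.\<close>
  then have "(x, z) \<in> (parcs G)\<^sup>*"
    using adj_mk_symmetric_eq sym_arcs by simp
  then show ?thesis
    using that z(2) by (auto elim: converse_rtranclE)
qed

section \<open>Slices of lexicographic products\<close>

text \<open>For distinct vertices \<open>v\<close> and \<open>w\<close>, these are the vertices
  separating them under the distance of \<open>H\<close> truncated at 2. Complementation exchanges
  the values 1 and 2, so \<open>H\<close> and its complement give the same set.\<close>

definition adjacency_resolving :: "'a pair_pre_digraph \<Rightarrow> 'a \<Rightarrow> 'a \<Rightarrow> 'a set" where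
  "adjacency_resolving H v w =
    {z \<in> pverts H. z = v \<or> z = w \<or> ((v, z) \<in> parcs H \<longleftrightarrow> (w, z) \<notin> parcs H)}"

definition adjacency_generator :: "nat \<Rightarrow> 'a pair_pre_digraph \<Rightarrow> 'a set \<Rightarrow> bool" where
  "adjacency_generator k H A \<longleftrightarrow> A \<subseteq> pverts H \<and>
    (\<forall>v\<in>pverts H. \<forall>w\<in>pverts H. v \<noteq> w \<longrightarrow> k \<le> card (A \<inter> adjacency_resolving H v w))"

lemma parcs_lex_product_iff:
  assumes "inj_on u {1..n}" "i \<in> {1..n}" "j \<in> {1..n}"
  shows "((u i, v), (u j, w)) \<in> parcs (lex_product G n u F) \<longleftrightarrow>
    v \<in> pverts (F i) \<and> w \<in> pverts (F j) \<and> ((u i, u j) \<in> parcs G \<or> i = j \<and> (v, w) \<in> parcs (F i))"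
  (is "?l \<longleftrightarrow> ?r")
proof
  assume ?l
  then obtain i' j' where ij: "i' \<in> {1..n}" "j' \<in> {1..n}" "u i = u i'" "u j = u j'"
    and *: "v \<in> pverts (F i')" "w \<in> pverts (F j')"
      "(u i', u j') \<in> parcs G \<or> i' = j' \<and> (v, w) \<in> parcs (F i')"
    by (auto simp: lex_product_def simp del: atLeastAtMost_iff)
  have "i' = i" "j' = j"
    using assms ij by (simp_all add: inj_on_eq_iff)
  with * show ?r
    by simp
next
  assume ?r
  then have "u i = u i \<and> u j = u j \<and> i \<in> {1..n} \<and> j \<in> {1..n} \<and> v \<in> pverts (F i) \<and> w \<in> pverts (F j) \<and>
      ((u i, u j) \<in> parcs G \<or> i = j \<and> (v, w) \<in> parcs (F i))"
    using assms by simp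
  then show ?l
    unfolding lex_product_def pair_pre_digraph.simps mem_Collect_eq prod.inject by metis
qed

section \<open>Distances in the product with a family of complements\<close>

locale lex_complement =
  fixes G :: "'a pair_pre_digraph" and n :: nat and u :: "nat \<Rightarrow> 'a"
    and H :: "nat \<Rightarrow> 'b pair_pre_digraph"
  assumes pair_graph_G: "pair_graph G"
    and connected_G: "connected (with_proj G)"
    and n_ge_2: "n \<ge> 2"
    and bij_u: "bij_betw u {1..n} (pverts G)"
    and finite_H: "\<And>i. i \<in> {1..n} \<Longrightarrow> finite (pverts (H i))"
    and nonempty_H: "\<And>i. i \<in> {1..n} \<Longrightarrow> pverts (H i) \<noteq> {}"
begin

sublocale G: pair_graph G
  by (rule pair_graph_G)

text \<open>\<open>H i\<close> stands for the graph before complementation, so that conditions on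
  the copies can be read in the paths and cycles themselves.\<close>

definition L :: "('a \<times> 'b) pair_pre_digraph" where
  "L = lex_product G n u (\<lambda>i. complement_graph (H i))"

lemma u_eq_iff: "i \<in> {1..n} \<Longrightarrow> j \<in> {1..n} \<Longrightarrow> u i = u j \<longleftrightarrow> i = j"
  using bij_betw_imp_inj_on[OF bij_u] by (rule inj_on_eq_iff)

lemma pverts_G: "pverts G = u ` {1..n}"
  using bij_u by (simp add: bij_betw_def)

lemma pverts_L: "pverts L = (\<Union>i\<in>{1..n}. {u i} \<times> pverts (H i))"
  by (simp add: L_def lex_product_def complement_graph_def)

lemma pverts_L_iff:
  assumes "i \<in> {1..n}"
  shows "(u i, v) \<in> pverts L \<longleftrightarrow> v \<in> pverts (H i)"
proof
  assume "(u i, v) \<in> pverts L"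
  then obtain j where "j \<in> {1..n}" "u i = u j" "v \<in> pverts (H j)"
    unfolding pverts_L by blast
  then show "v \<in> pverts (H i)"
    using u_eq_iff[OF assms] by simp
qed (use assms in \<open>unfold pverts_L, blast\<close>)

lemma pverts_L_cases:
  assumes "x \<in> pverts L"
  obtains i v where "i \<in> {1..n}" "x = (u i, v)" "v \<in> pverts (H i)"
  using assms by (auto simp: pverts_L)

lemma parcs_L_iff:
  assumes "i \<in> {1..n}" "j \<in> {1..n}"
  shows "((u i, v), (u j, w)) \<in> parcs L \<longleftrightarrow> v \<in> pverts (H i) \<and> w \<in> pverts (H j) \<and>
    ((u i, u j) \<in> parcs G \<or> i = j \<and> v \<noteq> w \<and> (v, w) \<notin> parcs (H i))"
  unfolding L_def parcs_lex_product_iff[OF bij_betw_imp_inj_on[OF bij_u] assms]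
  by (auto simp: complement_graph_def)

lemma wf_L: "pair_wf_digraph L"
  by unfold_locales (auto simp: L_def lex_product_def complement_graph_def)

lemma finite_L: "finite (pverts L)"
  by (auto simp: pverts_L finite_H)

lemma has_neighbour:
  assumes "i \<in> {1..n}"
  obtains j where "j \<in> {1..n}" "j \<noteq> i" "(u i, u j) \<in> parcs G"
proof -
  have "card (pverts G) = n"
    using bij_u bij_betw_same_card by fastforce
  then obtain y where y: "(u i, y) \<in> parcs G"
    using connected_has_neighbour[OF pair_graph_G connected_G, of "u i"] n_ge_2 assms
    by (auto simp: pverts_G)
  moreover obtain j where "j \<in> {1..n}" "y = u j"
    using G.in_arcsD2[OF y] unfolding pverts_G by blast
  ultimately show ?thesis
    using that G.no_loops' by blast
qed

lemma not_loop_G: "(x, x) \<notin> parcs G"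
  using G.no_loops' by blast

lemma graph_dist_eq_1_iff_L:
  assumes "i \<in> {1..n}" "j \<in> {1..n}" "i \<noteq> j" "v \<in> pverts (H i)" "w \<in> pverts (H j)"
  shows "graph_dist L (u i, v) (u j, w) = 1 \<longleftrightarrow> (u i, u j) \<in> parcs G"
  using assms graph_dist_eq_1_iff[OF wf_L, of "(u i, v)" "(u j, w)"]
  by (simp add: pverts_L_iff parcs_L_iff u_eq_iff)

text \<open>A copy joined to copy \<open>i\<close> supplies a common neighbour of \<open>v\<close>
  and \<open>z\<close>, so distances inside a copy never exceed 2. Distance 1 is adjacency in the
  complement, which is why arcs of \<open>H i\<close> give 2.\<close>

lemma graph_dist_same_copy:
  assumes "i \<in> {1..n}" "v \<in> pverts (H i)" "z \<in> pverts (H i)"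
  shows "graph_dist L (u i, v) (u i, z) =
    (if v = z then 0 else if (v, z) \<in> parcs (H i) then 2 else 1)"
proof -
  obtain j where j: "j \<in> {1..n}" "j \<noteq> i" "(u i, u j) \<in> parcs G"
    using has_neighbour assms(1) by blast
  obtain w where w: "w \<in> pverts (H j)"
    using nonempty_H j(1) by blast
  have "graph_dist L (u i, v) (u i, z) = 2" if "v \<noteq> z" "(v, z) \<in> parcs (H i)"
    using wf_L
  proof (rule graph_dist_eq_2I)
    show "((u i, v), (u j, w)) \<in> parcs L" "((u j, w), (u i, z)) \<in> parcs L"
      using assms j w G.arcs_symmetric by (auto simp: parcs_L_iff)
    show "((u i, v), (u i, z)) \<notin> parcs L"
      using that assms by (auto simp: parcs_L_iff not_loop_G)
  qed (use that in auto)
  then show ?thesis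
    using assms graph_dist_eq_0_iff[OF wf_L, of "(u i, v)" "(u i, z)"]
      graph_dist_eq_1_iff[OF wf_L, of "(u i, v)" "(u i, z)"]
    by (auto simp: pverts_L_iff parcs_L_iff)
qed

text \<open>The part of a walk after its last vertex in a copy can be started from any vertex of that copy.\<close>

lemma relpow_swap_start:
  assumes "((u i, v), (u l, z)) \<in> parcs L ^^ m" "i \<in> {1..n}" "l \<in> {1..n}" "l \<noteq> i"
    and "v' \<in> pverts (H i)"
  shows "\<exists>k\<le>m. ((u i, v'), (u l, z)) \<in> parcs L ^^ k"
  using assms(1)
proof (induction m arbitrary: v)
  case 0
  then show ?case
    using assms by (auto simp: u_eq_iff)
next
  case (Suc m)
  interpret L: pair_wf_digraph L by (rule wf_L)
  obtain b where b: "((u i, v), b) \<in> parcs L" "(b, (u l, z)) \<in> parcs L ^^ m"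
    using Suc.prems by (meson relpow_Suc_D2)
  obtain j w where j: "j \<in> {1..n}" "b = (u j, w)" "w \<in> pverts (H j)"
    using b(1) L.in_arcsD2 pverts_L_cases by metis
  show ?case
  proof (cases "j = i")
    \<comment> \<open>The first arc stays inside copy \<open>i\<close>: it is dropped, and the
      induction hypothesis handles the rest of the walk.\<close>
    case True
    then show ?thesis
      using Suc.IH b(2) j(2) le_SucI by blast
  next
    \<comment> \<open>An arc leaving the copy comes from an arc of \<open>G\<close>, so it can
      equally well start at \<open>v'\<close>.\<close>
    case False
    then have "((u i, v'), b) \<in> parcs L"
      using b(1) j assms by (auto simp: parcs_L_iff)
    then show ?thesis
      using b(2) by (meson order_refl relpow_Suc_I2)
  qed
qed

lemma graph_dist_other_copy:
  assumes "i \<in> {1..n}" "l \<in> {1..n}" "l \<noteq> i" "v \<in> pverts (H i)" "v' \<in> pverts (H i)"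
  shows "graph_dist L (u i, v) (u l, z) = graph_dist L (u i, v') (u l, z)"
  using assms by (intro graph_dist_cong wf_L relpow_swap_start) (auto simp: pverts_L_iff)

section \<open>Slices, and pairs in the same copy\<close>

definition slice :: "('a \<times> 'b) set \<Rightarrow> nat \<Rightarrow> 'b set" where
  "slice S i = {z. (u i, z) \<in> S}"

lemma union_of_slices:
  assumes "S \<subseteq> pverts L"
  shows "S = (\<Union>i\<in>{1..n}. {u i} \<times> slice S i)"
  using assms by (auto simp: slice_def pverts_L)

lemma card_union:
  assumes "\<And>i. i \<in> {1..n} \<Longrightarrow> A i \<subseteq> pverts (H i)"
  shows "card (\<Union>i\<in>{1..n}. {u i} \<times> A i) = (\<Sum>i=1..n. card (A i))"
proof -
  have "card (\<Union>i\<in>{1..n}. {u i} \<times> A i) = (\<Sum>i=1..n. card ({u i} \<times> A i))"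
    using assms finite_H finite_subset
    by (intro card_UN_disjoint) (auto simp: u_eq_iff, blast)
  then show ?thesis
    by (simp add: card_cartesian_product_singleton)
qed

text \<open>Vertices of other copies contribute nothing by \<open>graph_dist_other_copy\<close>;
  inside the copy the values 0, 1, 2 differ exactly on the adjacency resolving set.\<close>

lemma resolving_same_copy:
  assumes "S \<subseteq> pverts L" "i \<in> {1..n}" "v \<in> pverts (H i)" "w \<in> pverts (H i)" "v \<noteq> w"
  shows "{x \<in> S. graph_dist L (u i, v) x \<noteq> graph_dist L (u i, w) x} =
    {u i} \<times> (slice S i \<inter> adjacency_resolving (H i) v w)" (is "?l = ?r")
proof (intro set_eqI iffI)
  fix x assume x: "x \<in> ?l"
  then obtain j z where j: "j \<in> {1..n}" "x = (u j, z)" "z \<in> pverts (H j)"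
    using assms(1) pverts_L_cases by blast
  have "j = i"
    using x j assms graph_dist_other_copy[of i j v w z] by auto
  then show "x \<in> ?r"
    using x j assms
    by (auto simp: slice_def adjacency_resolving_def graph_dist_same_copy split: if_splits)
next
  fix x assume "x \<in> ?r"
  then show "x \<in> ?l"
    using assms
    by (auto simp: slice_def adjacency_resolving_def graph_dist_same_copy split: if_splits)
qed

lemma adjacency_generator_slice:
  assumes "metric_generator k L S" "i \<in> {1..n}"
  shows "adjacency_generator k (H i) (slice S i)"
  unfolding adjacency_generator_def
proof (intro conjI ballI impI)
  have S: "S \<subseteq> pverts L"
    using assms(1) by (simp add: metric_generator_def)
  then show "slice S i \<subseteq> pverts (H i)"
    using assms(2) by (auto simp: slice_def pverts_L_iff dest!: subsetD)
  fix v w assume vw: "v \<in> pverts (H i)" "w \<in> pverts (H i)" "v \<noteq> w"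
  then have "k \<le> card {x \<in> S. graph_dist L (u i, v) x \<noteq> graph_dist L (u i, w) x}"
    using assms by (auto simp: metric_generator_def pverts_L_iff)
  then show "k \<le> card (slice S i \<inter> adjacency_resolving (H i) v w)"
    using S assms(2) vw by (simp add: resolving_same_copy card_cartesian_product_singleton)
qed

text \<open>From \<open>v\<close> the distance to \<open>z\<close> is 0 or 1, since non-adjacency in
  \<open>H i\<close> means equality or adjacency in the complement; from a copy not joined to copy
  \<open>i\<close> it is neither.\<close>

lemma resolving_far:
  assumes "i \<in> {1..n}" "j \<in> {1..n}" "i \<noteq> j" "v \<in> pverts (H i)" "w \<in> pverts (H j)"
    and "(u j, u i) \<notin> parcs G" "z \<in> pverts (H i)" "(v, z) \<notin> parcs (H i)"
  shows "graph_dist L (u i, v) (u i, z) \<noteq> graph_dist L (u j, w) (u i, z)"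
proof -
  have "graph_dist L (u j, w) (u i, z) \<noteq> 0"
    using assms graph_dist_eq_0_iff[OF wf_L, of "(u j, w)" "(u i, z)"]
    by (simp add: pverts_L_iff u_eq_iff)
  moreover have "graph_dist L (u j, w) (u i, z) \<noteq> 1"
    using assms graph_dist_eq_1_iff_L[of j i w z] by simp
  ultimately show ?thesis
    using assms(8) unfolding graph_dist_same_copy[OF assms(1,4,7)] by (simp split: if_splits)
qed

text \<open>From a joined copy the distance to \<open>z\<close> is 1, whereas from \<open>v\<close>
  it is 0 or 2 on the closed neighbourhood taken in \<open>H i\<close>.\<close>

lemma resolving_near:
  assumes "i \<in> {1..n}" "j \<in> {1..n}" "i \<noteq> j" "v \<in> pverts (H i)" "w \<in> pverts (H j)"
    and "(u j, u i) \<in> parcs G" "z \<in> pverts (H i)" "z \<in> closed_nbhd (H i) v"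
  shows "graph_dist L (u i, v) (u i, z) \<noteq> graph_dist L (u j, w) (u i, z)"
proof -
  have "graph_dist L (u j, w) (u i, z) = 1"
    using assms graph_dist_eq_1_iff_L[of j i w z] by simp
  then show ?thesis
    using assms(8) unfolding graph_dist_same_copy[OF assms(1,4,7)] closed_nbhd_def
    by auto
qed

text \<open>
  Two vertices in different copies are resolved by half of \<open>k\<close> vertices in each of the two copies:
  by the non-neighbours in \<open>H i\<close> if the copies are not joined, and by the closed neighbourhood
  in \<open>H i\<close> if they are. Joined copies over vertices of \<open>G\<close> that are not twins are also
  resolved by all the chosen vertices of a third copy.
\<close>

lemma metric_generator_union:
  fixes A :: "nat \<Rightarrow> 'b set"
  assumes gen: "\<And>i. i \<in> {1..n} \<Longrightarrow> adjacency_generator k (H i) (A i)"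
    and far: "\<And>i v. i \<in> {1..n} \<Longrightarrow> v \<in> pverts (H i) \<Longrightarrow>
      k \<le> 2 * card (A i - {z. (v, z) \<in> parcs (H i)})"
    and near: "((\<forall>x\<in>pverts G. \<forall>y\<in>pverts G. x \<noteq> y \<longrightarrow> closed_nbhd G x \<noteq> closed_nbhd G y) \<and>
        (\<forall>i\<in>{1..n}. k \<le> card (A i))) \<or>
      (\<forall>i\<in>{1..n}. \<forall>v\<in>pverts (H i). k \<le> 2 * card (A i \<inter> closed_nbhd (H i) v))"
  shows "metric_generator k L (\<Union>i\<in>{1..n}. {u i} \<times> A i)"
  unfolding metric_generator_def
proof (intro conjI ballI impI)
  let ?S = "\<Union>i\<in>{1..n}. {u i} \<times> A i"
  have A: "A i \<subseteq> pverts (H i)" if "i \<in> {1..n}" for i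
    using gen that by (auto simp: adjacency_generator_def)
  then show sub: "?S \<subseteq> pverts L"
    unfolding pverts_L by blast
  have slice: "slice ?S i = A i" if "i \<in> {1..n}" for i
    using that u_eq_iff[OF that] unfolding slice_def by blast
  fix x y assume "x \<in> pverts L" "y \<in> pverts L" "x \<noteq> y"
  then obtain i v j w where i: "i \<in> {1..n}" "x = (u i, v)" "v \<in> pverts (H i)"
    and j: "j \<in> {1..n}" "y = (u j, w)" "w \<in> pverts (H j)"
    using pverts_L_cases by metis
  let ?R = "{z \<in> ?S. graph_dist L x z \<noteq> graph_dist L y z}"
  have finR: "finite ?R"
    using sub finite_L finite_subset by fastforce
  have two: "k \<le> card ?R"
    if ij: "i \<noteq> j" and sub_R: "{u i} \<times> P \<subseteq> ?R" "{u j} \<times> Q \<subseteq> ?R"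
      and P: "k \<le> 2 * card P" and Q: "k \<le> 2 * card Q" for P Q
  proof -
    have "card ({u i} \<times> P \<union> {u j} \<times> Q) = card ({u i} \<times> P) + card ({u j} \<times> Q)"
      using i j ij finR sub_R finite_subset by (intro card_Un_disjoint) (auto simp: u_eq_iff)
    moreover have "card ({u i} \<times> P \<union> {u j} \<times> Q) \<le> card ?R"
      using finR sub_R by (intro card_mono) auto
    ultimately show ?thesis
      using P Q by (simp add: card_cartesian_product_singleton)
  qed
  show "k \<le> card ?R"
  proof (cases "i = j")
    case True
    then show ?thesis
      using gen[OF i(1)] i j \<open>x \<noteq> y\<close> slice resolving_same_copy[OF sub, of i v w]
      by (auto simp: adjacency_generator_def card_cartesian_product_singleton)
  next
    case ij: False
    show ?thesis
    proof (cases "(u i, u j) \<in> parcs G")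
      case False
      then have ji: "(u j, u i) \<notin> parcs G"
        using G.arcs_symmetric by blast
      show ?thesis
      proof (rule two[OF ij _ _ far[OF i(1) i(3)] far[OF j(1) j(3)]])
        show "{u i} \<times> (A i - {z. (v, z) \<in> parcs (H i)}) \<subseteq> ?R"
          using resolving_far[OF i(1) j(1) ij i(3) j(3) ji] A[OF i(1)] i(1,2) j(2) by blast
        show "{u j} \<times> (A j - {z. (w, z) \<in> parcs (H j)}) \<subseteq> ?R"
          using resolving_far[OF j(1) i(1) ij[symmetric] j(3) i(3) False, THEN not_sym]
            A[OF j(1)] j(1,2) i(2) by blast
      qed
    next
      case adj: True
      then have adj': "(u j, u i) \<in> parcs G"
        using G.arcs_symmetric by blast
      from near show ?thesis
      proof (elim disjE conjE)
        assume twin: "\<forall>x\<in>pverts G. \<forall>y\<in>pverts G. x \<noteq> y \<longrightarrow> closed_nbhd G x \<noteq> closed_nbhd G y"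
          and k: "\<forall>i\<in>{1..n}. k \<le> card (A i)"
        have "closed_nbhd G (u i) \<noteq> closed_nbhd G (u j)"
          using twin i j ij by (auto simp: pverts_G u_eq_iff)
        then obtain t where "t \<in> closed_nbhd G (u i) \<longleftrightarrow> t \<notin> closed_nbhd G (u j)"
          by blast
        \<comment> \<open>Being adjacent, \<open>u i\<close> and \<open>u j\<close> lie in both
          closed neighbourhoods, so the separating vertex is a third one, adjacent to exactly one of
          them.\<close>
        then have t: "t \<noteq> u i" "t \<noteq> u j" "(u i, t) \<in> parcs G \<longleftrightarrow> (u j, t) \<notin> parcs G"
          using adj adj' unfolding closed_nbhd_def by auto
        then have "t \<in> pverts G"
          using G.in_arcsD2 by blast
        then obtain l where l: "l \<in> {1..n}" "t = u l"
          by (auto simp: pverts_G)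
        \<comment> \<open>All of copy \<open>l\<close> is at distance 1 from exactly one of
          \<open>x\<close> and \<open>y\<close>, so its chosen vertices alone provide
          \<open>k\<close>.\<close>
        have "{u l} \<times> A l \<subseteq> ?R"
        proof
          fix z assume z: "z \<in> {u l} \<times> A l"
          then obtain b where b: "z = (u l, b)" "b \<in> pverts (H l)"
            using A l(1) by auto
          have "i \<noteq> l" "j \<noteq> l"
            using t l by auto
          then have "graph_dist L x z = 1 \<longleftrightarrow> graph_dist L y z \<noteq> 1"
            using i j l t(3) b by (simp add: graph_dist_eq_1_iff_L)
          then show "z \<in> ?R"
            using z l(1) by auto
        qed
        then have "card ({u l} \<times> A l) \<le> card ?R"
          by (intro card_mono finR)
        then show ?thesis
          using k l(1) by (auto simp: card_cartesian_product_singleton intro: order_trans)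
      next
        assume near: "\<forall>i\<in>{1..n}. \<forall>v\<in>pverts (H i). k \<le> 2 * card (A i \<inter> closed_nbhd (H i) v)"
        show ?thesis
        proof (rule two[OF ij])
          show "{u i} \<times> (A i \<inter> closed_nbhd (H i) v) \<subseteq> ?R"
            using resolving_near[OF i(1) j(1) ij i(3) j(3) adj'] A[OF i(1)] i(1,2) j(2) by blast
          show "{u j} \<times> (A j \<inter> closed_nbhd (H j) w) \<subseteq> ?R"
            using resolving_near[OF j(1) i(1) ij[symmetric] j(3) i(3) adj, THEN not_sym]
              A[OF j(1)] j(1,2) i(2) by blast
        qed (use near i j in auto)
      qed
    qed
  qed
qed

text \<open>Every slice of a metric generator is an adjacency generator, so \<open>min\<close>
  applied copy by copy gives the lower bound. For the upper bound, \<open>far\<close> and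
  \<open>near\<close> let the union of the \<open>A i\<close> resolve pairs in different copies as
  well.\<close>

theorem metric_dim_eq_sum:
  assumes gen: "\<And>i. i \<in> {1..n} \<Longrightarrow> adjacency_generator k (H i) (A i)"
    and min: "\<And>i B. i \<in> {1..n} \<Longrightarrow> adjacency_generator k (H i) B \<Longrightarrow> card (A i) \<le> card B"
    and far: "\<And>i v. i \<in> {1..n} \<Longrightarrow> v \<in> pverts (H i) \<Longrightarrow>
      k \<le> 2 * card (A i - {z. (v, z) \<in> parcs (H i)})"
    and near: "((\<forall>x\<in>pverts G. \<forall>y\<in>pverts G. x \<noteq> y \<longrightarrow> closed_nbhd G x \<noteq> closed_nbhd G y) \<and>
        (\<forall>i\<in>{1..n}. k \<le> card (A i))) \<or>
      (\<forall>i\<in>{1..n}. \<forall>v\<in>pverts (H i). k \<le> 2 * card (A i \<inter> closed_nbhd (H i) v))"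
  shows "metric_dim k L = (\<Sum>i=1..n. card (A i))"
  unfolding metric_dim_def
proof (rule Least_equality)
  show "\<exists>S. metric_generator k L S \<and> card S = (\<Sum>i=1..n. card (A i))"
    using metric_generator_union[OF gen far near] card_union gen
    unfolding adjacency_generator_def by blast
  fix m assume "\<exists>S. metric_generator k L S \<and> card S = m"
  then obtain S where S: "metric_generator k L S" "card S = m"
    by blast
  have slices: "adjacency_generator k (H i) (slice S i)" if "i \<in> {1..n}" for i
    using adjacency_generator_slice[OF S(1) that] .
  have "(\<Sum>i=1..n. card (A i)) \<le> (\<Sum>i=1..n. card (slice S i))"
    using min slices by (intro sum_mono) auto
  also have "\<dots> = m"
    using S card_union[of "slice S"] slices union_of_slices[of S]
    by (simp add: metric_generator_def adjacency_generator_def)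
  finally show "(\<Sum>i=1..n. card (A i)) \<le> m" .
qed

end

section \<open>Adjacency generators\<close>

lemma adjacency_resolving_commute: "adjacency_resolving H v w = adjacency_resolving H w v"
  by (auto simp: adjacency_resolving_def)

text \<open>The generator condition seen from the omitted vertices: a window \<open>P\<close> around
  a resolving set can lose only what exceeds \<open>k\<close>. This form suits the path with
  \<open>k = 3\<close>, where few vertices are omitted.\<close>

lemma adjacency_generator_card_Diff:
  assumes "adjacency_generator k H A" "v \<in> pverts H" "w \<in> pverts H" "v \<noteq> w"
    and "adjacency_resolving H v w \<subseteq> P" "finite P"
  shows "k + card (P - A) \<le> card P"
proof -
  have "k \<le> card (A \<inter> adjacency_resolving H v w)"
    using assms by (auto simp: adjacency_generator_def)
  also have "\<dots> \<le> card (P \<inter> A)"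
    using assms by (intro card_mono) auto
  also have "card (P \<inter> A) + card (P - A) = card P"
    using assms(6) card_Int_Diff by metis
  finally show ?thesis by simp
qed

lemma card_le_1_iff: "finite X \<Longrightarrow> card X \<le> 1 \<longleftrightarrow> (\<forall>x\<in>X. \<forall>y\<in>X. x = y)"
  by (metis One_nat_def card_le_Suc0_iff_eq)

text \<open>Double counting: for each fixed offset \<open>t\<close>, every element of
  \<open>B\<close> is met by exactly one window position \<open>s\<close>.\<close>

lemma sum_card_hits:
  assumes "finite I" "finite T" "\<And>t. t \<in> T \<Longrightarrow> bij_betw (\<lambda>s. g s t) {s \<in> I. g s t \<in> B} B"
  shows "(\<Sum>s\<in>I. card {t \<in> T. g s t \<in> B}) = card T * card B"
proof -
  have "(\<Sum>s\<in>I. card {t \<in> T. g s t \<in> B}) = (\<Sum>s\<in>I. \<Sum>t\<in>T. of_bool (g s t \<in> B))"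
    using assms(2) by (simp add: sum.If_cases of_bool_def Int_def)
  also have "\<dots> = (\<Sum>t\<in>T. card {s \<in> I. g s t \<in> B})"
    using assms(1) by (subst sum.swap) (simp add: sum.If_cases of_bool_def Int_def)
  also have "\<dots> = (\<Sum>t\<in>T. card B)"
    using assms(3) by (intro sum.cong refl bij_betw_same_card)
  finally show ?thesis by simp
qed

lemma pverts_path [simp]: "pverts (path_graph q) = {0..<q}"
  by (simp add: path_graph_def)

lemma parcs_path_iff [simp]:
  "(a, b) \<in> parcs (path_graph q) \<longleftrightarrow> a < q \<and> b < q \<and> (b = Suc a \<or> a = Suc b)"
  by (simp add: path_graph_def)

lemma pverts_cycle [simp]: "pverts (cycle_graph q) = {0..<q}"
  by (simp add: cycle_graph_def)

lemma parcs_cycle_iff: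
  "(a, b) \<in> parcs (cycle_graph q) \<longleftrightarrow> a < q \<and> b < q \<and> (b = Suc a mod q \<or> a = Suc b mod q)"
  by (simp add: cycle_graph_def)

lemma card_Diff_ge:
  assumes "finite P" "\<forall>x\<in>P. \<forall>y\<in>P. x \<in> B \<longrightarrow> y \<in> B \<longrightarrow> x = y"
  shows "card P \<le> card (P - B) + 1"
proof -
  have "card (P \<inter> B) \<le> 1"
    using assms by (subst card_le_1_iff) auto
  then show ?thesis
    using card_Int_Diff[OF assms(1), of B] by simp
qed

section \<open>Paths\<close>

text \<open>If \<open>w = v + 2\<close>, the vertex in between is adjacent to both and resolves
  nothing. Writing \<open>Suc z = v\<close> instead of \<open>z = v - 1\<close> gives the vertex 0
  no predecessor.\<close>

lemma adjacency_resolving_path: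
  assumes "v < w" "w < q"
  shows "adjacency_resolving (path_graph q) v w =
    {z. z < q \<and> (z = v \<or> z = w \<or> z = Suc w \<or> Suc z = v \<or>
      (z = Suc v \<or> Suc z = w) \<and> w \<noteq> v + 2)}"
  using assms by (auto simp: adjacency_resolving_def)

lemma adjacency_generator_path_iff:
  "adjacency_generator k (path_graph q) A \<longleftrightarrow> A \<subseteq> {0..<q} \<and>
    (\<forall>v w. v < w \<longrightarrow> w < q \<longrightarrow> k \<le> card (A \<inter> adjacency_resolving (path_graph q) v w))"
  unfolding adjacency_generator_def
  by (auto, metis adjacency_resolving_commute nat_neq_iff)

section \<open>Paths with \<open>k = 2\<close>\<close>

lemma adjacency_2_generator_path:
  assumes "q \<ge> 4"
  shows "adjacency_generator 2 (path_graph q) ((\<lambda>t. min (2 * t) (q - 1)) ` {..q div 2})"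
proof -
  \<comment> \<open>The even vertices together with the end \<open>q - 1\<close>: the minimum takes
    effect only for even \<open>q\<close>, where \<open>t = q div 2\<close> would overshoot.\<close>
  define A where "A = (\<lambda>t. min (2 * t) (q - 1)) ` {..q div 2}"
  have sub: "z < q" if "z \<in> A" for z
    using that assms by (auto simp: A_def)
  have even: "z \<in> A" if "even z" "z < q" for z
    unfolding A_def using that by (intro image_eqI[of _ _ "z div 2"]) auto
  have last: "q - 1 \<in> A"
    unfolding A_def by (intro image_eqI[of _ _ "q div 2"]) auto
  have "adjacency_generator 2 (path_graph q) A"
    unfolding adjacency_generator_path_iff
  proof (intro conjI allI impI)
    show "A \<subseteq> {0..<q}"
      using sub by auto
    fix v w assume vw: "v < w" "w < q"
    \<comment> \<open>A chosen vertex among \<open>v - 1, v\<close> and one among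
      \<open>w, w + 1\<close> resolve the pair, and they are distinct as
      \<open>v < w\<close>.\<close>
    obtain a where a: "a \<in> A" "a \<le> v" "v \<le> Suc a"
    proof (cases "even v")
      case True
      then show ?thesis
        using that[of v] even[of v] vw by simp
    next
      case False
      then show ?thesis
        using that[of "v - 1"] even[of "v - 1"] vw by simp
    qed
    obtain b where b: "b \<in> A" "w \<le> b" "b \<le> Suc w"
    proof (cases "even w \<or> Suc w = q")
      case True
      then show ?thesis
        using that[of w] even[of w] last vw by auto
    next
      case False
      then show ?thesis
        using that[of "Suc w"] even[of "Suc w"] vw by simp
    qed
    have "a \<in> adjacency_resolving (path_graph q) v w" "b \<in> adjacency_resolving (path_graph q) v w"
      unfolding adjacency_resolving_path[OF vw] using a b sub[OF b(1)] vw by auto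
    then have "{a, b} \<subseteq> A \<inter> adjacency_resolving (path_graph q) v w"
      using a(1) b(1) by simp
    moreover have "finite A"
      by (simp add: A_def)
    ultimately have "card {a, b} \<le> card (A \<inter> adjacency_resolving (path_graph q) v w)"
      by (intro card_mono) auto
    then show "2 \<le> card (A \<inter> adjacency_resolving (path_graph q) v w)"
      using a b vw by simp
  qed
  then show ?thesis
    by (simp only: A_def)
qed

lemma card_adjacency_2_generator_path:
  assumes "q \<ge> 4"
  shows "card ((\<lambda>t. min (2 * t) (q - 1)) ` {..q div 2}) = q div 2 + 1"
proof -
  have "inj_on (\<lambda>t. min (2 * t) (q - 1)) {..q div 2}"
  proof (rule inj_onI)
    fix x y assume "x \<in> {..q div 2}" "y \<in> {..q div 2}" "min (2 * x) (q - 1) = min (2 * y) (q - 1)"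
    then show "x = y"
      using assms unfolding min_def atMost_iff by presburger
  qed
  then show ?thesis
    by (simp add: card_image)
qed

text \<open>
  Adding windows of 4 shows that every initial segment \<open>{..<j}\<close> contains at least \<open>j / 2\<close> chosen
  vertices; for \<open>j = q - 3\<close>, the last three vertices then contribute 2 more.
\<close>

lemma adjacency_2_generator_path_lower:
  assumes "q \<ge> 4" "adjacency_generator 2 (path_graph q) A"
  shows "q div 2 + 1 \<le> card A"
proof -
  define f :: "nat \<Rightarrow> nat" where "f = (\<lambda>z. of_bool (z \<in> A))"
  have f_le: "f z \<le> 1" for z
    by (simp add: f_def)
  have A: "A \<subseteq> {0..<q}"
    using assms(2) by (simp add: adjacency_generator_path_iff)
  then have finA: "finite A"
    using finite_subset by blast
  have sum_f: "(\<Sum>z\<in>P. f z) = card (A \<inter> P)" if "finite P" for P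
    using that by (simp add: f_def of_bool_def sum.If_cases Int_commute)
  have hits: "2 \<le> (\<Sum>z\<in>P. f z)"
    if "v < w" "w < q" "adjacency_resolving (path_graph q) v w \<subseteq> P" "finite P" for v w P
  proof -
    have "2 \<le> card (A \<inter> adjacency_resolving (path_graph q) v w)"
      using assms(2) that(1,2) by (simp add: adjacency_generator_path_iff)
    also have "\<dots> \<le> card (A \<inter> P)"
      using that(3) finA by (intro card_mono) auto
    finally show ?thesis
      by (simp add: sum_f that(4))
  qed
  have f012: "2 \<le> f 0 + f 1 + f 2"
    using hits[of 0 1 "{0, 1, 2}"] assms(1) by (force simp: adjacency_resolving_path)
  have f023: "2 \<le> f 0 + f 2 + f 3"
    using hits[of 0 2 "{0, 2, 3}"] assms(1) by (force simp: adjacency_resolving_path)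
  have window: "2 \<le> f s + f (s + 1) + f (s + 2) + f (s + 3)" if "s + 3 < q" for s
    using hits[of "s + 1" "s + 2" "{s, s + 1, s + 2, s + 3}"] that
    by (force simp: adjacency_resolving_path)
  have last: "2 \<le> f (q - 3) + f (q - 2) + f (q - 1)"
  proof -
    have "adjacency_resolving (path_graph q) (q - 2) (q - 1) \<subseteq> {q - 3, q - 2, q - 1}"
      using assms(1) by (auto simp: adjacency_resolving_path)
    moreover have "q - 3 \<noteq> q - 2" "q - 3 \<noteq> q - 1" "q - 2 \<noteq> q - 1"
      using assms(1) by simp_all
    ultimately show ?thesis
      using hits[of "q - 2" "q - 1" "{q - 3, q - 2, q - 1}"] assms(1) by (simp add: add.assoc)
  qed
  have prefix: "j \<le> 2 * (\<Sum>z<j. f z)" if "2 \<le> j" "j < q" for j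
    using that
  proof (induction j rule: less_induct)
    case (less j)
    \<comment> \<open>The induction goes back by 4, so the base cases are 2 to 5. For
      \<open>j = 5\<close> three chosen vertices are needed: if 0 is chosen,
      \<open>window[of 1]\<close> gives two more; otherwise \<open>f012\<close> and
      \<open>f023\<close> force 1, 2 and 3.\<close>
    consider "j = 2" | "j = 3" | "j = 4" | "j = 5" | "j \<ge> 6"
      using less.prems by linarith
    then show ?case
    proof cases
      case 5
      then have "j = Suc (Suc (Suc (Suc (j - 4))))"
        by simp
      then have "(\<Sum>z<j. f z) = (\<Sum>z<j - 4. f z) +
          (f (j - 4) + f (j - 4 + 1) + f (j - 4 + 2) + f (j - 4 + 3))"
        by (metis (no_types, lifting) sum.lessThan_Suc add.assoc add_Suc_right add_0_right
          numeral_2_eq_2 numeral_3_eq_3 One_nat_def)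
      then show ?thesis
        using less.IH[of "j - 4"] window[of "j - 4"] 5 less.prems by linarith
    qed (use f012 f023 window[of 1] f_le[of 0] f_le[of 1] f_le[of 2] f_le[of 3] f_le[of 4]
        less.prems in \<open>simp_all add: eval_nat_numeral\<close>)
  qed
  have total: "card A = (\<Sum>z<q. f z)"
    using A sum_f[of "{..<q}"] by (simp add: Int_absorb2 lessThan_atLeast0)
  show ?thesis
  proof (cases "q = 4")
    \<comment> \<open>Here \<open>q - 3 = 1\<close> lies outside the range of \<open>prefix\<close>.
      Instead, each of the four triples of vertices contains two chosen ones, so three times the
      total is at least 8.\<close>
    case True
    have "2 \<le> f 0 + f 1 + f 3"
      using hits[of 1 3 "{0, 1, 3}"] True by (force simp: adjacency_resolving_path)
    moreover have "card A = f 0 + f 1 + f 2 + f 3"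
      using total True by (simp add: eval_nat_numeral)
    moreover have "2 \<le> f 1 + f 2 + f 3"
      using last True by simp
    moreover have "q div 2 + 1 = 3"
      using True by simp
    ultimately show ?thesis
      using f012 f023 by linarith
  next
    case False
    have "q = Suc (Suc (Suc (q - 3)))"
      using assms(1) by simp
    then have "(\<Sum>z<q. f z) = (\<Sum>z<q - 3. f z) + (f (q - 3) + f (q - 2) + f (q - 1))"
      by (metis (no_types, lifting) sum.lessThan_Suc add.assoc diff_Suc_1 One_nat_def
        diff_Suc_Suc numeral_2_eq_2 diff_Suc_1)
    then show ?thesis
      using prefix[of "q - 3"] last False assms(1) total by linarith
  qed
qed

section \<open>Paths with \<open>k = 3\<close>\<close>

lemma adjacency_3_generator_path:
  assumes "q \<ge> 4"
  shows "adjacency_generator 3 (path_graph q) ({0..<q} - (\<lambda>t. 4 + 5 * t) ` {..<(q - 4) div 5})"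
proof -
  \<comment> \<open>The omitted vertices 4, 9, and so on; the bound on \<open>t\<close> keeps them
    away from the last four vertices.\<close>
  define B where "B = (\<lambda>t. 4 + 5 * t) ` {..<(q - 4) div 5}"
  have B: "4 \<le> z \<and> z + 5 \<le> q \<and> z mod 5 = 4" if "z \<in> B" for z
    using that by (auto simp: B_def)
  have B_eq: "x = y" if "x \<in> B" "y \<in> B" "x < y + 5" "y < x + 5" for x y
    using B[OF that(1)] B[OF that(2)] that(3,4) by presburger
  \<comment> \<open>Windows of 5 are needed because the resolving set
    \<open>{v - 1, v, v + 2, v + 3}\<close> of \<open>v, v + 2\<close> spans five positions.\<close>
  have most: "card P \<le> card (P - B) + 1" if "P \<subseteq> {s..<s + 5}" for P s
  proof (rule card_Diff_ge)
    show "finite P"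
      using that finite_subset by blast
    show "\<forall>x\<in>P. \<forall>y\<in>P. x \<in> B \<longrightarrow> y \<in> B \<longrightarrow> x = y"
    proof (intro ballI impI)
      fix x y assume "x \<in> P" "y \<in> P" "x \<in> B" "y \<in> B"
      moreover have "s \<le> x" "x < s + 5" "s \<le> y" "y < s + 5"
        using \<open>x \<in> P\<close> \<open>y \<in> P\<close> that by auto
      ultimately show "x = y"
        by (intro B_eq) auto
    qed
  qed
  have all: "P - B = P" if "\<forall>z\<in>P. z < 4 \<or> q < z + 5" for P
    using that B by fastforce
  have "adjacency_generator 3 (path_graph q) ({0..<q} - B)"
    unfolding adjacency_generator_path_iff
  proof (intro conjI allI impI)
    fix v w assume vw: "v < w" "w < q"
    let ?R = "adjacency_resolving (path_graph q) v w"
    have mono: "card (P - B) \<le> card (({0..<q} - B) \<inter> ?R)" if "P \<subseteq> ?R" for P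
      using that by (intro card_mono) (auto simp: adjacency_resolving_def)
    have all3: "3 \<le> card (({0..<q} - B) \<inter> ?R)" if "P \<subseteq> ?R" "\<forall>z\<in>P. z < 4 \<or> q < z + 5" "3 \<le> card P" for P
      using mono[OF that(1)] all[OF that(2)] that(3) by simp
    have most4: "3 \<le> card (({0..<q} - B) \<inter> ?R)" if "P \<subseteq> ?R" "P \<subseteq> {s..<s + 5}" "4 \<le> card P" for P s
      using mono[OF that(1)] most[OF that(2)] that(3) by simp
    consider "w = v + 1" | "w = v + 2" | "w \<ge> v + 3"
      using vw by linarith
    then show "3 \<le> card (({0..<q} - B) \<inter> ?R)"
    proof cases
      case 1
      show ?thesis
      proof (cases v)
        case 0
        then show ?thesis
          by (intro all3[of "{0, 1, 2}"]) (use 1 assms in \<open>auto simp: adjacency_resolving_path\<close>)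
      next
        case (Suc s)
        show ?thesis
        proof (cases "s + 3 = q")
          case True
          then show ?thesis
            by (intro all3[of "{s, s + 1, s + 2}"]) (use 1 Suc in \<open>auto simp: adjacency_resolving_path\<close>)
        next
          case False
          then show ?thesis
            by (intro most4[of "{s, s + 1, s + 2, s + 3}" s]) (use 1 Suc vw in \<open>auto simp: adjacency_resolving_path\<close>)
        qed
      qed
    next
      case 2
      show ?thesis
      proof (cases v)
        case 0
        then show ?thesis
          by (intro all3[of "{0, 2, 3}"]) (use 2 assms in \<open>auto simp: adjacency_resolving_path\<close>)
      next
        case (Suc s)
        show ?thesis
        proof (cases "s + 4 = q")
          case True
          then show ?thesis
            by (intro all3[of "{s, s + 1, s + 3}"]) (use 2 Suc in \<open>auto simp: adjacency_resolving_path\<close>)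
        next
          case False
          then show ?thesis
            by (intro most4[of "{s, s + 1, s + 3, s + 4}" s]) (use 2 Suc vw in \<open>auto simp: adjacency_resolving_path\<close>)
        qed
      qed
    next
      case 3
      \<comment> \<open>The closed neighbourhoods of \<open>v\<close> and \<open>w\<close> are
        disjoint and both resolve the pair. Each keeps at least two vertices, so at least four
        remain.\<close>
      define P where "P = {z. z < q \<and> (Suc z = v \<or> z = v \<or> z = Suc v)}"
      define Q where "Q = {z. z < q \<and> (Suc z = w \<or> z = w \<or> z = Suc w)}"
      have "2 \<le> card (P - B)"
      proof (cases v)
        case 0
        then have "P = {0, 1}"
          using assms by (auto simp: P_def)
        then show ?thesis
          using all[of P] by simp
      next
        case (Suc s)
        then have "P = {s, s + 1, s + 2}"
          using vw 3 by (auto simp: P_def)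
        then show ?thesis
          using most[of P s] by simp
      qed
      moreover obtain s where s: "w = Suc s"
        using vw by (cases w) auto
      have "2 \<le> card (Q - B)"
      proof (cases "Suc w = q")
        case True
        then have "Q = {s, s + 1}"
          using s by (auto simp: Q_def)
        then show ?thesis
          using all[of Q] True s by simp
      next
        case False
        then have "Q = {s, s + 1, s + 2}"
          using s vw by (auto simp: Q_def)
        then show ?thesis
          using most[of Q s] by simp
      qed
      moreover have "card ((P \<union> Q) - B) = card (P - B) + card (Q - B)"
        unfolding Un_Diff using 3 by (intro card_Un_disjoint) (auto simp: P_def Q_def)
      moreover have "P \<union> Q \<subseteq> ?R"
        using 3 vw by (auto simp: P_def Q_def adjacency_resolving_path)
      ultimately show ?thesis
        using mono[of "P \<union> Q"] by linarith
    qed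
  qed auto
  then show ?thesis
    by (simp only: B_def)
qed

lemma card_adjacency_3_generator_path:
  "card ({0..<q} - (\<lambda>t. 4 + 5 * t) ` {..<(q - 4) div 5}) = q - (q - 4) div 5"
proof -
  have "card ((\<lambda>t. 4 + 5 * t) ` {..<(q - 4) div 5}) = (q - 4) div 5"
    by (subst card_image) (auto simp: inj_on_def)
  then show ?thesis
    by (subst card_Diff_subset) auto
qed

text \<open>Any five consecutive vertices contain at most one omitted vertex, and each omitted
  vertex lies in five of the \<open>q - 4\<close> such windows; hence
  \<open>5 * card B \<le> q - 4\<close>.\<close>

lemma adjacency_3_generator_path_lower:
  assumes "q \<ge> 4" "adjacency_generator 3 (path_graph q) A"
  shows "q - (q - 4) div 5 \<le> card A"
proof -
  define B where "B = {0..<q} - A"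
  have A: "A \<subseteq> {0..<q}"
    using assms(2) by (simp add: adjacency_generator_path_iff)
  have miss: "card (P - A) + 3 \<le> card P"
    if "v < w" "w < q" "adjacency_resolving (path_graph q) v w \<subseteq> P" "finite P" for v w P
    using adjacency_generator_card_Diff[OF assms(2), of v w P] that by simp
  have sub: "P \<subseteq> A"
    if "v < w" "w < q" "adjacency_resolving (path_graph q) v w \<subseteq> P" "finite P" "card P \<le> 3" for v w P
  proof -
    have "card (P - A) = 0"
      using miss[OF that(1-4)] that(5) by simp
    then show ?thesis
      using that(4) by simp
  qed
  \<comment> \<open>Near the ends the resolving sets shrink to three vertices, all of which must be
    chosen.\<close>
  have "{0, 1, 2} \<subseteq> A"
    by (rule sub[of 0 1]) (use assms(1) in \<open>auto simp: adjacency_resolving_path\<close>)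
  moreover have "{0, 2, 3} \<subseteq> A"
    by (rule sub[of 0 2]) (use assms(1) in \<open>auto simp: adjacency_resolving_path\<close>)
  moreover have "{q - 3, q - 2, q - 1} \<subseteq> A"
    by (rule sub[of "q - 2" "q - 1"])
      (use assms(1) in \<open>auto simp: adjacency_resolving_path card_insert_if\<close>)
  moreover have "{q - 4, q - 3, q - 1} \<subseteq> A"
    by (rule sub[of "q - 3" "q - 1"])
      (use assms(1) in \<open>auto simp: adjacency_resolving_path card_insert_if\<close>)
  ultimately have ends: "{0, 1, 2, 3, q - 1, q - 2, q - 3, q - 4} \<subseteq> A"
    by simp
  have B: "4 \<le> b \<and> b + 5 \<le> q" if "b \<in> B" for b
  proof -
    have "b < q" "b \<notin> A"
      using that by (simp_all add: B_def)
    moreover from this have "b \<notin> {0, 1, 2, 3, q - 1, q - 2, q - 3, q - 4}"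
      using ends by blast
    ultimately show ?thesis
      unfolding insert_iff empty_iff by presburger
  qed
  have pair: "x = y" if "v < w" "w < q" "adjacency_resolving (path_graph q) v w \<subseteq> P" "finite P"
    "card P = 4" "x \<in> P \<inter> B" "y \<in> P \<inter> B" for v w P x y
  proof -
    have "card (P - A) \<le> 1"
      using miss[OF that(1-4)] that(5) by simp
    then have "\<forall>x\<in>P - A. \<forall>y\<in>P - A. x = y"
      using that(4) by (subst (asm) card_le_1_iff) auto
    then show ?thesis
      using that(6,7) by (auto simp: B_def)
  qed
  have close: "t = t'" if st: "s + 4 < q" "t \<le> t'" "t' \<le> 4" "s + t \<in> B" "s + t' \<in> B" for s t t'
  proof -
    \<comment> \<open>Two positions among five lie in the first four or in the last four, unless
      they are the two extremes; those are caught by the resolving set of \<open>s + 1\<close> and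
      \<open>s + 3\<close>.\<close>
    consider "t' \<le> 3" | "1 \<le> t" | "t = 0" "t' = 4"
      using st(3) by arith
    then have "s + t = s + t'"
    proof cases
      case 1
      have "adjacency_resolving (path_graph q) (s + 1) (s + 2) \<subseteq> {s..s + 3}"
        using st(1) by (auto simp: adjacency_resolving_path)
      then show ?thesis
        by (rule pair[rotated 2]) (use 1 st in simp_all)
    next
      case 2
      have "adjacency_resolving (path_graph q) (s + 2) (s + 3) \<subseteq> {s + 1..s + 4}"
        using st(1) by (auto simp: adjacency_resolving_path)
      then show ?thesis
        by (rule pair[rotated 2]) (use 2 st in simp_all)
    next
      case 3
      have "adjacency_resolving (path_graph q) (s + 1) (s + 3) \<subseteq> {s, s + 1, s + 3, s + 4}"
        using st(1) by (auto simp: adjacency_resolving_path)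
      then show ?thesis
        by (rule pair[rotated 2]) (use 3 st in simp_all)
    qed
    then show ?thesis
      by simp
  qed
  have "card {t \<in> {..4}. s + t \<in> B} \<le> 1" if "s < q - 4" for s
  proof -
    have "s + 4 < q"
      using that by simp
    then have "t = t'" if "t \<le> 4" "t' \<le> 4" "s + t \<in> B" "s + t' \<in> B" for t t'
      using close[of s t t'] close[of s t' t] that by (metis nat_le_linear)
    then show ?thesis
      by (subst card_le_1_iff) auto
  qed
  then have "(\<Sum>s<q - 4. card {t \<in> {..4}. s + t \<in> B}) \<le> (\<Sum>s<q - 4. 1)"
    by (intro sum_mono) auto
  moreover have "(\<Sum>s<q - 4. card {t \<in> {..4}. s + t \<in> B}) = card {..4::nat} * card B"
  proof (rule sum_card_hits)
    \<comment> \<open>An omitted \<open>b\<close> equals \<open>s + t\<close> only for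
      \<open>s = b - t\<close>; \<open>4 \<le> b\<close> and \<open>b + 5 \<le> q\<close> keep this
      \<open>s\<close> in range for all five offsets.\<close>
    fix t :: nat assume t: "t \<in> {..4}"
    show "bij_betw (\<lambda>s. s + t) {s \<in> {..<q - 4}. s + t \<in> B} B"
      using B t by (intro bij_betwI[where g = "\<lambda>b. b - t"]) force+
  qed auto
  ultimately have "5 * card B \<le> q - 4"
    by simp
  moreover have "card B = q - card A"
    using A finite_subset[OF A] by (simp add: B_def card_Diff_subset)
  ultimately show ?thesis
    by linarith
qed

section \<open>Cycles\<close>

lemma inj_on_rotate: "inj_on (\<lambda>t. (s + t) mod q) {0..<q}" for q :: nat
proof (rule linorder_inj_onI)
  fix x y assume xy: "x < y" "x \<in> {0..<q}" "y \<in> {0..<q}"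
  then have "\<not> q dvd (s + y) - (s + x)"
    by (simp add: nat_dvd_not_less)
  then show "(s + x) mod q \<noteq> (s + y) mod q"
    using mod_eq_dvd_iff_nat[of "s + x" "s + y" q] xy(1) by auto
qed auto

lemma bij_betw_rotate: "bij_betw (\<lambda>t. (s + t) mod q) {0..<q} {0..<q}" for q :: nat
proof -
  have "(\<lambda>t. (s + t) mod q) ` {0..<q} = {0..<q}"
    by (rule endo_inj_surj) (auto simp: inj_on_rotate)
  then show ?thesis
    by (simp add: bij_betw_def inj_on_rotate)
qed

lemma rotate_eq_iff: "a < q \<Longrightarrow> b < q \<Longrightarrow> (s + a) mod q = (s + b) mod q \<longleftrightarrow> a = b" for q :: nat
  using inj_on_eq_iff[OF inj_on_rotate, of a q b s] by simp

lemma parcs_cycle_rotate: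
  assumes "a < q" "b < q"
  shows "((s + a) mod q, (s + b) mod q) \<in> parcs (cycle_graph q) \<longleftrightarrow> (a, b) \<in> parcs (cycle_graph q)"
proof -
  have "(s + y) mod q = Suc ((s + x) mod q) mod q \<longleftrightarrow> y = Suc x mod q" if "x < q" "y < q" for x y
  proof -
    have "Suc ((s + x) mod q) mod q = (s + Suc x mod q) mod q"
      by (simp add: mod_Suc_eq mod_add_right_eq)
    then show ?thesis
      using rotate_eq_iff[of y q "Suc x mod q" s] that by simp
  qed
  then show ?thesis
    using assms by (simp add: parcs_cycle_iff)
qed

lemma adjacency_resolving_cycle_rotate:
  assumes "a < q" "b < q"
  shows "adjacency_resolving (cycle_graph q) ((s + a) mod q) ((s + b) mod q) =
    (\<lambda>t. (s + t) mod q) ` adjacency_resolving (cycle_graph q) a b" (is "?l = ?f ` ?r")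
proof -
  have *: "?f z \<in> ?l \<longleftrightarrow> z \<in> ?r" if "z < q" for z
    using that assms by (simp add: adjacency_resolving_def parcs_cycle_rotate rotate_eq_iff)
  show ?thesis
  proof (intro set_eqI iffI)
    fix x assume "x \<in> ?l"
    moreover from this have "x \<in> ?f ` {0..<q}"
      unfolding bij_betw_imp_surj_on[OF bij_betw_rotate] by (simp add: adjacency_resolving_def)
    ultimately show "x \<in> ?f ` ?r"
      using * by auto
  next
    fix x assume "x \<in> ?f ` ?r"
    then obtain z where z: "x = ?f z" "z \<in> ?r"
      by blast
    then have "z < q"
      by (simp add: adjacency_resolving_def)
    then show "x \<in> ?l"
      using * z by simp
  qed
qed

text \<open>Starting at 1 and requiring \<open>d + 3 \<le> q\<close> keeps
  \<open>0, ..., d + 2\<close> distinct below \<open>q\<close>, so the two neighbourhoods look as on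
  a path. For \<open>d = 2\<close> the common neighbour drops out.\<close>

lemma adjacency_resolving_cycle_1:
  assumes "1 \<le> d" "d + 3 \<le> q"
  shows "adjacency_resolving (cycle_graph q) 1 (1 + d) =
    {z. z = 0 \<or> z = 1 \<or> z = d + 1 \<or> z = d + 2 \<or> (z = 2 \<or> z = d) \<and> d \<noteq> 2}"
proof -
  have "(1, z) \<in> parcs (cycle_graph q) \<longleftrightarrow> z = 0 \<or> z = 2" if "z < q" for z
    using assms that by (auto simp: parcs_cycle_iff mod_Suc)
  moreover have "(1 + d, z) \<in> parcs (cycle_graph q) \<longleftrightarrow> z = d \<or> z = d + 2" if "z < q" for z
    using assms that by (auto simp: parcs_cycle_iff mod_Suc)
  ultimately show ?thesis
    using assms by (auto simp: adjacency_resolving_def)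
qed

text \<open>
  Rotating the shorter of the two arcs between \<open>v\<close> and \<open>w\<close> to start at \<open>1\<close> keeps both vertices
  and their neighbours clear of the wrap-around.
\<close>

lemma cycle_pair_cases:
  assumes "v < q" "w < q" "v \<noteq> w" "q \<ge> 5"
  obtains s d where "1 \<le> d" "d + 3 \<le> q"
    "adjacency_resolving (cycle_graph q) v w =
      (\<lambda>t. (s + t) mod q) ` adjacency_resolving (cycle_graph q) 1 (1 + d)"
proof -
  note witness = that
  have rot: thesis if x: "x < q" and d: "1 \<le> d" "d + 3 \<le> q"
    and R: "adjacency_resolving (cycle_graph q) v w =
      adjacency_resolving (cycle_graph q) x ((x + d) mod q)" for x d
  proof (rule witness[OF d])
    \<comment> \<open>The rotation taking 1 to \<open>x\<close>; adding \<open>q\<close> avoids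
      truncated subtraction at \<open>x = 0\<close>.\<close>
    define s where "s = x + q - 1"
    have "s + 1 = x + q" "s + (1 + d) = x + d + q"
      using x by (simp_all add: s_def)
    then have "(s + 1) mod q = x" "(s + (1 + d)) mod q = (x + d) mod q"
      using x by (simp_all only: mod_add_self2 mod_less)
    then show "adjacency_resolving (cycle_graph q) v w =
        (\<lambda>t. (s + t) mod q) ` adjacency_resolving (cycle_graph q) 1 (1 + d)"
      using adjacency_resolving_cycle_rotate[of 1 q "1 + d" s] d unfolding R by simp
  qed
  have ordered: thesis if ab: "a < b" "b < q"
    and R: "adjacency_resolving (cycle_graph q) v w = adjacency_resolving (cycle_graph q) a b" for a b
  proof (cases "b - a + 3 \<le> q")
    case True
    show ?thesis
      by (rule rot[of a "b - a"]) (use ab R True in simp_all)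
  next
    case False
    \<comment> \<open>Now \<open>b - a \<ge> q - 2\<close>, so going on from \<open>b\<close> round
      to \<open>a\<close> takes at most 2 steps; \<open>d + 3 \<le> q\<close> then follows from
      \<open>q \<ge> 5\<close>.\<close>
    define d where "d = q - (b - a)"
    have "b + d = a + q"
      using ab by (simp add: d_def)
    then have "(b + d) mod q = a"
      using ab by simp
    moreover have "1 \<le> d" "d + 3 \<le> q"
      using False ab assms(4) by (simp_all add: d_def)
    ultimately show ?thesis
      by (intro rot[of b d]) (use ab R in \<open>simp_all add: adjacency_resolving_commute\<close>)
  qed
  show thesis
  proof (cases "v < w")
    case True
    then show ?thesis
      using assms by (intro ordered[of v w]) simp_all
  next
    case False
    then show ?thesis
      using assms by (intro ordered[of w v] adjacency_resolving_commute) simp_all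
  qed
qed

lemma adjacency_resolving_cycle_1_subset:
  assumes "1 \<le> d" "d + 3 \<le> q"
  shows "adjacency_resolving (cycle_graph q) 1 (1 + d) \<subseteq> {0..<q}"
  by (auto simp: adjacency_resolving_def)

lemma card_Int_rotate:
  fixes q :: nat
  assumes "T \<subseteq> {0..<q}"
  shows "card (A \<inter> (\<lambda>t. (s + t) mod q) ` T) = card {t \<in> T. (s + t) mod q \<in> A}"
proof -
  have "inj_on (\<lambda>t. (s + t) mod q) {t \<in> T. (s + t) mod q \<in> A}"
    by (rule inj_on_subset[OF inj_on_rotate]) (use assms in auto)
  moreover have "A \<inter> (\<lambda>t. (s + t) mod q) ` T = (\<lambda>t. (s + t) mod q) ` {t \<in> T. (s + t) mod q \<in> A}"
    by auto
  ultimately show ?thesis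
    by (simp add: card_image)
qed

text \<open>By \<open>cycle_pair_cases\<close> every pair is a rotation of some
  \<open>1, 1 + d\<close>. The set \<open>T\<close> allows only the convenient part of the resolving
  set to be counted.\<close>

lemma adjacency_generator_cycleI:
  assumes "q \<ge> 5" "A \<subseteq> {0..<q}"
    and "\<And>s d. 1 \<le> d \<Longrightarrow> d + 3 \<le> q \<Longrightarrow> \<exists>T \<subseteq> adjacency_resolving (cycle_graph q) 1 (1 + d).
      k \<le> card {t \<in> T. (s + t) mod q \<in> A}"
  shows "adjacency_generator k (cycle_graph q) A"
  unfolding adjacency_generator_def
proof (intro conjI ballI impI)
  show "A \<subseteq> pverts (cycle_graph q)"
    using assms(2) by simp
  fix v w assume "v \<in> pverts (cycle_graph q)" "w \<in> pverts (cycle_graph q)" and ne: "v \<noteq> w"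
  then have v: "v < q" and w: "w < q"
    by simp_all
  obtain s d where d: "1 \<le> d" "d + 3 \<le> q"
    and R: "adjacency_resolving (cycle_graph q) v w =
      (\<lambda>t. (s + t) mod q) ` adjacency_resolving (cycle_graph q) 1 (1 + d)"
    by (rule cycle_pair_cases[OF v w ne assms(1)])
  obtain T where T: "T \<subseteq> adjacency_resolving (cycle_graph q) 1 (1 + d)"
    "k \<le> card {t \<in> T. (s + t) mod q \<in> A}"
    using assms(3)[OF d] by blast
  have sub: "adjacency_resolving (cycle_graph q) 1 (1 + d) \<subseteq> {0..<q}"
    by (rule adjacency_resolving_cycle_1_subset[OF d])
  have "k \<le> card {t \<in> adjacency_resolving (cycle_graph q) 1 (1 + d). (s + t) mod q \<in> A}"
    using T(2)
  proof (rule order_trans)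
    show "card {t \<in> T. (s + t) mod q \<in> A} \<le>
        card {t \<in> adjacency_resolving (cycle_graph q) 1 (1 + d). (s + t) mod q \<in> A}"
      using T(1) finite_subset[OF sub] by (intro card_mono) auto
  qed
  then show "k \<le> card (A \<inter> adjacency_resolving (cycle_graph q) v w)"
    unfolding R card_Int_rotate[OF sub] .
qed

lemma adjacency_generator_cycleD:
  assumes "adjacency_generator k (cycle_graph q) A" "1 \<le> d" "d + 3 \<le> q"
  shows "k \<le> card {t \<in> adjacency_resolving (cycle_graph q) 1 (1 + d). (s + t) mod q \<in> A}"
proof -
  have "(s + 1) mod q \<noteq> (s + (1 + d)) mod q"
    using rotate_eq_iff[of 1 q "1 + d" s] assms(2,3) by simp
  then have "k \<le> card (A \<inter> adjacency_resolving (cycle_graph q) ((s + 1) mod q) ((s + (1 + d)) mod q))"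
    using assms by (simp add: adjacency_generator_def)
  then show ?thesis
    using assms(2,3)
    by (simp only: adjacency_resolving_cycle_rotate[of 1 q "1 + d"]
        card_Int_rotate[OF adjacency_resolving_cycle_1_subset[OF assms(2,3)]])
qed

text \<open>The cases \<open>d = 1\<close> and \<open>d = 2\<close> in rotated position; they carry
  all the lower bounds for cycles.\<close>

lemma adjacency_generator_cycle_window:
  assumes "adjacency_generator k (cycle_graph q) A" "q \<ge> 5"
  shows "k \<le> card {t \<in> {0, 1, 2, 3}. (s + t) mod q \<in> A}"
    and "k \<le> card {t \<in> {0, 1, 3, 4}. (s + t) mod q \<in> A}"
proof -
  have d: "1 \<le> (1::nat)" "1 + 3 \<le> q" "1 \<le> (2::nat)" "2 + 3 \<le> q"
    using assms(2) by simp_all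
  have "adjacency_resolving (cycle_graph q) 1 (1 + 1) = {0, 1, 2, 3}"
    unfolding adjacency_resolving_cycle_1[OF d(1,2)] by auto
  then show "k \<le> card {t \<in> {0, 1, 2, 3}. (s + t) mod q \<in> A}"
    using adjacency_generator_cycleD[OF assms(1) d(1,2), of s] by (simp only:)
  have "adjacency_resolving (cycle_graph q) 1 (1 + 2) = {0, 1, 3, 4}"
    unfolding adjacency_resolving_cycle_1[OF d(3,4)] by auto
  then show "k \<le> card {t \<in> {0, 1, 3, 4}. (s + t) mod q \<in> A}"
    using adjacency_generator_cycleD[OF assms(1) d(3,4), of s] by (simp only:)
qed

lemma sum_card_hits_rotate:
  fixes q :: nat
  assumes "finite T" "B \<subseteq> {0..<q}"
  shows "(\<Sum>s\<in>{0..<q}. card {t \<in> T. (s + t) mod q \<in> B}) = card T * card B"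
proof (rule sum_card_hits)
  fix t assume "t \<in> T"
  have bij: "bij_betw (\<lambda>s. (s + t) mod q) {0..<q} {0..<q}"
    using bij_betw_rotate[of t q] by (simp add: add.commute)
  show "bij_betw (\<lambda>s. (s + t) mod q) {s \<in> {0..<q}. (s + t) mod q \<in> B} B"
  proof (rule bij_betw_subset[OF bij])
    show "(\<lambda>s. (s + t) mod q) ` {s \<in> {0..<q}. (s + t) mod q \<in> B} = B"
    proof (intro equalityI subsetI)
      fix x assume "x \<in> B"
      then have "x \<in> (\<lambda>s. (s + t) mod q) ` {0..<q}"
        using assms(2) bij_betw_imp_surj_on[OF bij] by (simp only: subset_iff)
      then show "x \<in> (\<lambda>s. (s + t) mod q) ` {s \<in> {0..<q}. (s + t) mod q \<in> B}"
        using \<open>x \<in> B\<close> by fast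
    qed fast
  qed fast
qed (simp_all add: assms(1))

section \<open>Cycles with \<open>k = 2\<close>\<close>

lemma adjacency_2_generator_cycle:
  assumes "q \<ge> 5"
  shows "adjacency_generator 2 (cycle_graph q) ((\<lambda>t. 2 * t) ` {..<(q + 1) div 2})"
proof -
  define A where "A = (\<lambda>t::nat. 2 * t) ` {..<(q + 1) div 2}"
  have even: "z \<in> A" if "even z" "z < q" for z
    unfolding A_def using that by (intro image_eqI[of _ _ "z div 2"]) auto
  \<comment> \<open>Two cyclically consecutive vertices always include an even one, the pair
    \<open>q - 1, 0\<close> because of 0. This is applied to the offsets \<open>0, 1\<close> and
    \<open>d + 1, d + 2\<close>.\<close>
  have step: "(s + t) mod q \<in> A \<or> (s + (t + 1)) mod q \<in> A" for s t
  proof -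
    define x where "x = (s + t) mod q"
    have x: "x < q"
      using assms by (simp add: x_def)
    have "(s + (t + 1)) mod q = (if Suc x = q then 0 else Suc x)"
      by (simp add: x_def mod_Suc)
    moreover have "x \<in> A \<or> (if Suc x = q then 0 else Suc x) \<in> A"
    proof (cases "even x")
      case True
      then show ?thesis
        using even[of x] x by blast
    next
      case False
      then show ?thesis
        using even[of 0] even[of "Suc x"] x by simp
    qed
    ultimately show ?thesis
      by (simp only: x_def)
  qed
  have "adjacency_generator 2 (cycle_graph q) A"
    using assms
  proof (rule adjacency_generator_cycleI)
    show "A \<subseteq> {0..<q}"
      by (auto simp: A_def)
    fix s d assume d: "1 \<le> d" "d + 3 \<le> q"
    obtain a where a: "a \<in> {0, 1}" "(s + a) mod q \<in> A"
      using step[of s 0] by fastforce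
    obtain b where b: "b \<in> {d + 1, d + 2}" "(s + b) mod q \<in> A"
      using step[of s "d + 1"] by fastforce
    have "{t \<in> {a, b}. (s + t) mod q \<in> A} = {a, b}"
      using a(2) b(2) by blast
    moreover have "a \<noteq> b"
      using a(1) b(1) d(1) by auto
    ultimately have "2 \<le> card {t \<in> {a, b}. (s + t) mod q \<in> A}"
      by (simp only:) simp
    moreover have "{a, b} \<subseteq> adjacency_resolving (cycle_graph q) 1 (1 + d)"
      unfolding adjacency_resolving_cycle_1[OF d] using a(1) b(1) by auto
    ultimately show "\<exists>T \<subseteq> adjacency_resolving (cycle_graph q) 1 (1 + d).
        2 \<le> card {t \<in> T. (s + t) mod q \<in> A}"
      by blast
  qed
  then show ?thesis
    by (simp only: A_def)
qed

lemma card_adjacency_2_generator_cycle: "card ((\<lambda>t::nat. 2 * t) ` {..<(q + 1) div 2}) = (q + 1) div 2"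
  by (subst card_image) (auto simp: inj_on_def)

text \<open>Averaging over the \<open>q\<close> rotations of a window of 4 gives
  \<open>2 * q \<le> 4 * card A\<close>.\<close>

lemma adjacency_2_generator_cycle_lower:
  assumes "q \<ge> 5" "adjacency_generator 2 (cycle_graph q) A"
  shows "(q + 1) div 2 \<le> card A"
proof -
  have "(\<Sum>s\<in>{0..<q}. 2) \<le> (\<Sum>s\<in>{0..<q}. card {t \<in> {0, 1, 2, 3}. (s + t) mod q \<in> A})"
    by (intro sum_mono adjacency_generator_cycle_window(1)[OF assms(2,1)])
  also have "\<dots> = card {0, 1, 2, 3 :: nat} * card A"
    using assms(2) by (intro sum_card_hits_rotate) (auto simp: adjacency_generator_def)
  finally show ?thesis
    by simp
qed

section \<open>Cycles with \<open>k = 3\<close>\<close>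

lemma adjacency_3_generator_cycle:
  assumes "q \<ge> 5"
  shows "adjacency_generator 3 (cycle_graph q) ({0..<q} - (\<lambda>t. 5 * t) ` {..<q div 5})"
proof -
  define B where "B = (\<lambda>t::nat. 5 * t) ` {..<q div 5}"
  have B: "z + 5 \<le> q \<and> z mod 5 = 0" if "z \<in> B" for z
    using that by (auto simp: B_def)
  have close: "t = t'" if tt: "t \<le> t'" "t' < t + 5" "(s + t) mod q \<in> B" "(s + t') mod q \<in> B" for s t t'
  proof -
    define z where "z = (s + t) mod q"
    have z: "z \<in> B"
      using tt(3) by (simp only: z_def)
    \<comment> \<open>Every omitted \<open>z\<close> satisfies \<open>z + 5 \<le> q\<close>, so a
      step of at most 4 does not wrap around; the gap across 0 is thus also at least 5.\<close>
    have less: "z + (t' - t) < q"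
      using B[OF z] tt(1,2) by arith
    have "(s + t') mod q = (z + (t' - t)) mod q"
      unfolding z_def mod_add_left_eq using tt(1) by simp
    then have "z + (t' - t) \<in> B"
      using tt(4) less by (simp only: mod_less)
    then show ?thesis
      using B[of "z + (t' - t)"] B[OF z] tt(1,2) by presburger
  qed
  have most: "card T \<le> card (T - {t. (s + t) mod q \<in> B}) + 1" if T: "T \<subseteq> {a..<a + 5}" for T s a
  proof (rule card_Diff_ge)
    show "finite T"
      using T finite_subset by blast
    show "\<forall>x\<in>T. \<forall>y\<in>T. x \<in> {t. (s + t) mod q \<in> B} \<longrightarrow> y \<in> {t. (s + t) mod q \<in> B} \<longrightarrow> x = y"
    proof (intro ballI impI)
      fix x y assume xy: "x \<in> T" "y \<in> T" "x \<in> {t. (s + t) mod q \<in> B}" "y \<in> {t. (s + t) mod q \<in> B}"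
      have "a \<le> x" "x < a + 5" "a \<le> y" "y < a + 5"
        using xy(1,2) T by auto
      then show "x = y"
        using close[of x y s] close[of y x s] xy(3,4) by (cases "x \<le> y") auto
    qed
  qed
  have "adjacency_generator 3 (cycle_graph q) ({0..<q} - B)"
    using assms
  proof (rule adjacency_generator_cycleI)
    fix s d assume d: "1 \<le> d" "d + 3 \<le> q"
    have hits: "{t \<in> T. (s + t) mod q \<in> {0..<q} - B} = T - {t. (s + t) mod q \<in> B}" for T
      using assms by auto
    note R = adjacency_resolving_cycle_1[OF d]
    have "\<exists>T \<subseteq> adjacency_resolving (cycle_graph q) 1 (1 + d).
        3 \<le> card (T - {t. (s + t) mod q \<in> B})"
    \<comment> \<open>For \<open>d \<le> 2\<close> four resolving vertices lie within five
      consecutive positions and lose at most one. For larger \<open>d\<close> two disjoint triples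
      each lose at most one.\<close>
    proof (cases "d \<le> 2")
      case True
      have "3 \<le> card ({0, 1, d + 1, d + 2} - {t. (s + t) mod q \<in> B})"
        using most[of "{0, 1, d + 1, d + 2}" 0 s] True d(1) by simp
      moreover have "{0, 1, d + 1, d + 2} \<subseteq> adjacency_resolving (cycle_graph q) 1 (1 + d)"
        unfolding R by auto
      ultimately show ?thesis
        by blast
    next
      case False
      let ?P = "{0, 1, 2} - {t. (s + t) mod q \<in> B}" and ?Q = "{d, d + 1, d + 2} - {t. (s + t) mod q \<in> B}"
      have "2 \<le> card ?P" "2 \<le> card ?Q"
        using most[of "{0, 1, 2}" 0 s] most[of "{d, d + 1, d + 2}" d s] by simp_all
      moreover have "card (?P \<union> ?Q) = card ?P + card ?Q"
        using False by (intro card_Un_disjoint) auto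
      ultimately have "3 \<le> card (({0, 1, 2} \<union> {d, d + 1, d + 2}) - {t. (s + t) mod q \<in> B})"
        unfolding Un_Diff by linarith
      moreover have "{0, 1, 2} \<union> {d, d + 1, d + 2} \<subseteq> adjacency_resolving (cycle_graph q) 1 (1 + d)"
        unfolding R using False by auto
      ultimately show ?thesis
        by blast
    qed
    then show "\<exists>T \<subseteq> adjacency_resolving (cycle_graph q) 1 (1 + d).
        3 \<le> card {t \<in> T. (s + t) mod q \<in> {0..<q} - B}"
      unfolding hits .
  qed auto
  then show ?thesis
    by (simp only: B_def)
qed

lemma card_adjacency_3_generator_cycle:
  "card ({0..<q} - (\<lambda>t. 5 * t) ` {..<q div 5}) = q - q div 5"
proof -
  have "card ((\<lambda>t::nat. 5 * t) ` {..<q div 5}) = q div 5"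
    by (subst card_image) (auto simp: inj_on_def)
  then show ?thesis
    by (subst card_Diff_subset) auto
qed

text \<open>As on paths, five consecutive positions contain at most one omitted vertex. There are no
  ends, so all \<open>q\<close> rotations of the window count and
  \<open>5 * card B \<le> q\<close>.\<close>

lemma adjacency_3_generator_cycle_lower:
  assumes "q \<ge> 5" "adjacency_generator 3 (cycle_graph q) A"
  shows "q - q div 5 \<le> card A"
proof -
  define B where "B = {0..<q} - A"
  have A: "A \<subseteq> {0..<q}"
    using assms(2) by (simp add: adjacency_generator_def)
  have pair: "t = t'" if T: "finite T" "card T = 4" "3 \<le> card {t \<in> T. (s + t) mod q \<in> A}"
    and t: "t \<in> T" "t' \<in> T" "(s + t) mod q \<in> B" "(s + t') mod q \<in> B" for T s t t'
  proof -
    have "card {t \<in> T. (s + t) mod q \<in> A} + card {t \<in> T. (s + t) mod q \<in> B} = card T"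
    proof (subst card_Un_disjoint[symmetric])
      have "(s + t) mod q < q" for t
        using assms(1) by simp
      then have "{t \<in> T. (s + t) mod q \<in> A} \<union> {t \<in> T. (s + t) mod q \<in> B} = T"
        unfolding B_def by fastforce
      then show "card ({t \<in> T. (s + t) mod q \<in> A} \<union> {t \<in> T. (s + t) mod q \<in> B}) = card T"
        by (simp only:)
    qed (use T(1) in \<open>auto simp: B_def\<close>)
    then have "card {t \<in> T. (s + t) mod q \<in> B} \<le> 1"
      using T(2,3) by simp
    then show ?thesis
      using T(1) t card_le_1_iff[of "{t \<in> T. (s + t) mod q \<in> B}"] by simp
  qed
  have close: "t = t'" if st: "t \<le> t'" "t' \<le> 4" "(s + t) mod q \<in> B" "(s + t') mod q \<in> B" for s t t'
  proof -
    have low: "x \<in> {0, 1, 2, 3}" if "x \<le> 3" for x :: nat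
      unfolding insert_iff empty_iff using that by arith
    have window: "t = t'" if "t \<le> 3" "t' \<le> 3" "(s + t) mod q \<in> B" "(s + t') mod q \<in> B" for s t t'
      by (rule pair[OF _ _ adjacency_generator_cycle_window(1)[OF assms(2,1)]
            low[OF that(1)] low[OF that(2)] that(3,4)]) simp_all
    consider "t' \<le> 3" | "1 \<le> t" | "t = 0" "t' = 4"
      using st(2) by arith
    then show ?thesis
    proof cases
      case 1
      show ?thesis
        by (rule window[OF _ 1 st(3,4)]) (use 1 st(1) in simp)
    next
      case 2
      \<comment> \<open>Positions 1 to 4 are positions 0 to 3 of the window starting at
        \<open>s + 1\<close>.\<close>
      then have t: "s + t = s + 1 + (t - 1)" "s + t' = s + 1 + (t' - 1)" "t - 1 \<le> 3" "t' - 1 \<le> 3"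
        using st(1,2) by simp_all
      have "t - 1 = t' - 1"
        using window[OF t(3,4)] st(3,4) unfolding t(1,2) .
      then show ?thesis
        using 2 st(1) by simp
    next
      case 3
      have t: "t \<in> {0, 1, 3, 4}" "t' \<in> {0, 1, 3, 4}"
        unfolding 3 by simp_all
      show ?thesis
        by (rule pair[OF _ _ adjacency_generator_cycle_window(2)[OF assms(2,1)] t st(3,4)]) simp_all
    qed
  qed
  have "card {t \<in> {..4}. (s + t) mod q \<in> B} \<le> 1" for s
  proof -
    have "t = t'" if "t \<le> 4" "t' \<le> 4" "(s + t) mod q \<in> B" "(s + t') mod q \<in> B" for t t'
      using close[of t t' s] close[of t' t s] that by (metis nat_le_linear)
    then show ?thesis
      by (subst card_le_1_iff) auto
  qed
  then have "(\<Sum>s\<in>{0..<q}. card {t \<in> {..4}. (s + t) mod q \<in> B}) \<le> (\<Sum>s\<in>{0..<q}. 1)"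
    by (intro sum_mono) auto
  moreover have "(\<Sum>s\<in>{0..<q}. card {t \<in> {..4}. (s + t) mod q \<in> B}) = card {..4::nat} * card B"
    by (intro sum_card_hits_rotate) (auto simp: B_def)
  ultimately have "5 * card B \<le> q"
    by simp
  moreover have "card B = q - card A"
    using A finite_subset[OF A] by (simp add: B_def card_Diff_subset)
  ultimately show ?thesis
    by linarith
qed

section \<open>Cycles with \<open>k = 4\<close>\<close>

lemma adjacency_4_generator_cycle:
  assumes "q \<ge> 5"
  shows "adjacency_generator 4 (cycle_graph q) {0..<q}"
  using assms
proof (rule adjacency_generator_cycleI)
  fix s d assume d: "1 \<le> d" "d + 3 \<le> q"
  have "{t \<in> {0, 1, d + 1, d + 2}. (s + t) mod q \<in> {0..<q}} = {0, 1, d + 1, d + 2}"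
    using assms by auto
  then have "4 \<le> card {t \<in> {0, 1, d + 1, d + 2}. (s + t) mod q \<in> {0..<q}}"
    using d(1) by simp
  moreover have "{0, 1, d + 1, d + 2} \<subseteq> adjacency_resolving (cycle_graph q) 1 (1 + d)"
    unfolding adjacency_resolving_cycle_1[OF d] by auto
  ultimately show "\<exists>T \<subseteq> adjacency_resolving (cycle_graph q) 1 (1 + d).
      4 \<le> card {t \<in> T. (s + t) mod q \<in> {0..<q}}"
    by blast
qed auto

lemma adjacency_4_generator_cycle_lower:
  assumes "q \<ge> 5" "adjacency_generator 4 (cycle_graph q) A"
  shows "q \<le> card A"
proof -
  have "z \<in> A" if "z < q" for z
  proof -
    \<comment> \<open>Four hits in a window of 4 force the whole window into \<open>A\<close>, in
      particular its first vertex \<open>z\<close>.\<close>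
    have "{t \<in> {0, 1, 2, 3}. (z + t) mod q \<in> A} = {0, 1, 2, 3}"
    proof (rule card_seteq)
      show "card {0, 1, 2, 3 :: nat} \<le> card {t \<in> {0, 1, 2, 3}. (z + t) mod q \<in> A}"
        using adjacency_generator_cycle_window(1)[OF assms(2,1), of z] by simp
    qed auto
    then have "(z + 0) mod q \<in> A"
      by blast
    then show ?thesis
      using that by simp
  qed
  moreover have "finite A"
    using assms(2) finite_subset by (auto simp: adjacency_generator_def)
  ultimately have "card {0..<q} \<le> card A"
    by (intro card_mono) auto
  then show ?thesis
    by simp
qed

section \<open>Lexicographic products with complements of paths and cycles\<close>

lemma neighbours_path: "\<exists>a b. {z. (v, z) \<in> parcs (path_graph q)} \<subseteq> {a, b}"
  by (intro exI[of _ "v - 1"] exI[of _ "Suc v"]) auto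

lemma neighbours_cycle: "\<exists>a b. {z. (v, z) \<in> parcs (cycle_graph q)} \<subseteq> {a, b}"
proof -
  have "z = (if v = 0 then q - 1 else v - 1)" if "z < q" "v = Suc z mod q" for z
    using that by (simp add: mod_Suc split: if_splits)
  then have "{z. (v, z) \<in> parcs (cycle_graph q)} \<subseteq> {Suc v mod q, if v = 0 then q - 1 else v - 1}"
    unfolding parcs_cycle_iff by blast
  then show ?thesis
    by blast
qed

text \<open>Two vertices from each of two joined copies make the four needed for
  \<open>k = 4\<close>, whether or not \<open>G\<close> has twins.\<close>

lemma two_le_card_closed_nbhd_cycle:
  assumes "q \<ge> 2" "v < q"
  shows "2 \<le> card ({0..<q} \<inter> closed_nbhd (cycle_graph q) v)"
proof -
  have "v \<noteq> Suc v mod q"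
    using assms by (auto simp: mod_Suc)
  moreover have "card {v, Suc v mod q} \<le> card ({0..<q} \<inter> closed_nbhd (cycle_graph q) v)"
    using assms by (intro card_mono) (auto simp: closed_nbhd_def parcs_cycle_iff)
  ultimately show ?thesis
    by simp
qed

text \<open>A vertex has at most two neighbours in \<open>H i\<close>, so at least
  \<open>a i - 2\<close> chosen vertices are non-neighbours; \<open>large\<close> makes this at
  least half of \<open>k\<close>.\<close>

lemma (in lex_complement) metric_dim_eq_sum_card:
  assumes gen: "\<And>i. i \<in> {1..n} \<Longrightarrow> adjacency_generator k (H i) (A i)"
    and card: "\<And>i. i \<in> {1..n} \<Longrightarrow> card (A i) = a i"
    and min: "\<And>i B. i \<in> {1..n} \<Longrightarrow> adjacency_generator k (H i) B \<Longrightarrow> a i \<le> card B"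
    and large: "\<And>i. i \<in> {1..n} \<Longrightarrow> k + 4 \<le> 2 * a i"
    and degree: "\<And>i v. i \<in> {1..n} \<Longrightarrow> \<exists>a b. {z. (v, z) \<in> parcs (H i)} \<subseteq> {a, b}"
    and near: "((\<forall>x\<in>pverts G. \<forall>y\<in>pverts G. x \<noteq> y \<longrightarrow> closed_nbhd G x \<noteq> closed_nbhd G y) \<and>
        (\<forall>i\<in>{1..n}. k \<le> a i)) \<or>
      (\<forall>i\<in>{1..n}. \<forall>v\<in>pverts (H i). k \<le> 2 * card (A i \<inter> closed_nbhd (H i) v))"
  shows "metric_dim k L = (\<Sum>i=1..n. a i)"
proof -
  have "metric_dim k L = (\<Sum>i=1..n. card (A i))"
  proof (rule metric_dim_eq_sum)
    show "card (A i) \<le> card B" if "i \<in> {1..n}" "adjacency_generator k (H i) B" for i B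
      using min[OF that] card[OF that(1)] by simp
    show "k \<le> 2 * card (A i - {z. (v, z) \<in> parcs (H i)})" if i: "i \<in> {1..n}" for i v
    proof -
      have fin: "finite (A i)"
        using gen[OF i] finite_H[OF i] finite_subset by (auto simp: adjacency_generator_def)
      obtain a b where "{z. (v, z) \<in> parcs (H i)} \<subseteq> {a, b}"
        using degree[OF i, of v] by blast
      then have "card (A i - {a, b}) \<le> card (A i - {z. (v, z) \<in> parcs (H i)})"
        using fin by (intro card_mono) auto
      moreover have "card {a, b} \<le> 2"
        by (simp add: card_insert_if)
      ultimately show ?thesis
        using large[OF i] card[OF i] diff_card_le_card_Diff[of "{a, b}" "A i"] by simp
    qed
    show "((\<forall>x\<in>pverts G. \<forall>y\<in>pverts G. x \<noteq> y \<longrightarrow> closed_nbhd G x \<noteq> closed_nbhd G y) \<and>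
        (\<forall>i\<in>{1..n}. k \<le> card (A i))) \<or>
      (\<forall>i\<in>{1..n}. \<forall>v\<in>pverts (H i). k \<le> 2 * card (A i \<inter> closed_nbhd (H i) v))"
      using near card by simp
  qed (fact gen)
  then show ?thesis
    using card by simp
qed

section \<open>Rounding and splitting of sums\<close>

lemma ceiling_half: "\<lceil>real m / 2\<rceil> = int ((m + 1) div 2)"
proof (rule ceiling_unique)
  have "m \<le> 2 * ((m + 1) div 2)" "2 * ((m + 1) div 2) \<le> m + 1"
    by simp_all
  then have "real m \<le> real (2 * ((m + 1) div 2))" "real (2 * ((m + 1) div 2)) \<le> real (m + 1)"
    by (simp_all only: of_nat_le_iff)
  then show "real_of_int (int ((m + 1) div 2)) - 1 < real m / 2"
    "real m / 2 \<le> real_of_int (int ((m + 1) div 2))"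
    by simp_all
qed

lemma floor_div_5: "\<lfloor>real m / 5\<rfloor> = int (m div 5)"
  using floor_divide_of_nat_eq[of m 5] by simp

lemma int_sum_split:
  fixes a b :: "nat \<Rightarrow> nat" and c d :: "nat \<Rightarrow> int"
  assumes "r \<le> n" "\<And>i. i \<in> {1..r} \<Longrightarrow> int (a i) = c i" "\<And>i. i \<in> {r+1..n} \<Longrightarrow> int (b i) = d i"
  shows "int (\<Sum>i=1..n. if i \<le> r then a i else b i) = (\<Sum>i=1..r. c i) + (\<Sum>i=r+1..n. d i)"
proof -
  obtain p where n: "n = r + p"
    using assms(1) le_Suc_ex by blast
  have "(\<Sum>i=1..n. int (if i \<le> r then a i else b i)) =
      (\<Sum>i=1..r. int (if i \<le> r then a i else b i)) + (\<Sum>i=r+1..n. int (if i \<le> r then a i else b i))"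
    unfolding n by (rule sum.ub_add_nat) simp
  also have "\<dots> = (\<Sum>i=1..r. c i) + (\<Sum>i=r+1..n. d i)"
    using assms(2,3) by (intro arg_cong2[where f = "(+)"] sum.cong) auto
  finally show ?thesis
    by simp
qed

theorem theorem18:
  fixes G :: "'a pair_pre_digraph" and u :: "nat \<Rightarrow> 'a" and q :: "nat \<Rightarrow> nat" and n r :: nat
  assumes "pair_graph G" and "connected (with_proj G)"
    and "n \<ge> 2" and "bij_betw u {1..n} (pverts G)"
  shows
    "((\<forall>x\<in>pverts G. \<forall>y\<in>pverts G. x \<noteq> y \<longrightarrow> closed_nbhd G x \<noteq> closed_nbhd G y) \<and>
      r \<le> n \<and> (\<forall>i\<in>{1..r}. q i \<ge> 4) \<and> (\<forall>i\<in>{r+1..n}. q i \<ge> 5) \<longrightarrow>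
      (let H = (\<lambda>i. if i \<le> r then path_graph (q i) else cycle_graph (q i));
           GH = lex_product G n u (\<lambda>i. complement_graph (H i))
       in int (metric_dim 2 GH) =
            (\<Sum>i=1..r. \<lceil>(real (q i) + 1) / 2\<rceil>) + (\<Sum>i=r+1..n. \<lceil>real (q i) / 2\<rceil>) \<and>
          int (metric_dim 3 GH) =
            (\<Sum>i=1..r. int (q i) - \<lfloor>(real (q i) - 4) / 5\<rfloor>) +
            (\<Sum>i=r+1..n. int (q i) - \<lfloor>real (q i) / 5\<rfloor>))) \<and>
     ((\<forall>i\<in>{1..n}. q i \<ge> 5) \<longrightarrow>
      metric_dim 4 (lex_product G n u (\<lambda>i. complement_graph (cycle_graph (q i)))) = (\<Sum>i=1..n. q i))"
proof (intro conjI impI)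
  assume hyps: "(\<forall>x\<in>pverts G. \<forall>y\<in>pverts G. x \<noteq> y \<longrightarrow> closed_nbhd G x \<noteq> closed_nbhd G y) \<and>
    r \<le> n \<and> (\<forall>i\<in>{1..r}. q i \<ge> 4) \<and> (\<forall>i\<in>{r+1..n}. q i \<ge> 5)"
  define H where "H = (\<lambda>i. if i \<le> r then path_graph (q i) else cycle_graph (q i))"
  have q: "(i \<le> r \<and> H i = path_graph (q i) \<and> 4 \<le> q i) \<or>
      (\<not> i \<le> r \<and> H i = cycle_graph (q i) \<and> 5 \<le> q i)" if "i \<in> {1..n}" for i
    using that hyps by (auto simp: H_def)
  interpret lex_complement G n u H
  proof (rule lex_complement.intro[OF assms])
    fix i assume i: "i \<in> {1..n}"
    show "finite (pverts (H i))" "pverts (H i) \<noteq> {}"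
      using q[OF i] by auto
  qed
  have degree: "\<exists>a b. {z. (v, z) \<in> parcs (H i)} \<subseteq> {a, b}" for i v
    unfolding H_def using neighbours_path neighbours_cycle by presburger
  have L: "lex_product G n u (\<lambda>i. complement_graph (H i)) = L"
    by (simp only: L_def)
  have twin: "\<forall>x\<in>pverts G. \<forall>y\<in>pverts G. x \<noteq> y \<longrightarrow> closed_nbhd G x \<noteq> closed_nbhd G y" and r: "r \<le> n"
    using hyps by blast+
  have dim2: "metric_dim 2 L = (\<Sum>i=1..n. if i \<le> r then q i div 2 + 1 else (q i + 1) div 2)"
  proof (rule metric_dim_eq_sum_card[where A = "\<lambda>i. if i \<le> r
      then (\<lambda>t. min (2 * t) (q i - 1)) ` {..q i div 2} else (\<lambda>t. 2 * t) ` {..<(q i + 1) div 2}"])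
    fix i assume i: "i \<in> {1..n}"
    show "adjacency_generator 2 (H i) (if i \<le> r
      then (\<lambda>t. min (2 * t) (q i - 1)) ` {..q i div 2} else (\<lambda>t. 2 * t) ` {..<(q i + 1) div 2})"
      using q[OF i] adjacency_2_generator_path adjacency_2_generator_cycle by auto
    show "card (if i \<le> r then (\<lambda>t. min (2 * t) (q i - 1)) ` {..q i div 2}
        else (\<lambda>t. 2 * t) ` {..<(q i + 1) div 2}) = (if i \<le> r then q i div 2 + 1 else (q i + 1) div 2)"
      using q[OF i] card_adjacency_2_generator_path card_adjacency_2_generator_cycle by auto
    show "(if i \<le> r then q i div 2 + 1 else (q i + 1) div 2) \<le> card B"
      if "adjacency_generator 2 (H i) B" for B
      using q[OF i] that adjacency_2_generator_path_lower adjacency_2_generator_cycle_lower by auto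
    show "2 + 4 \<le> 2 * (if i \<le> r then q i div 2 + 1 else (q i + 1) div 2)"
      using q[OF i] by auto
  next
    have "2 \<le> (if i \<le> r then q i div 2 + 1 else (q i + 1) div 2)" if "i \<in> {1..n}" for i
      using q[OF that] by auto
    then show "((\<forall>x\<in>pverts G. \<forall>y\<in>pverts G. x \<noteq> y \<longrightarrow> closed_nbhd G x \<noteq> closed_nbhd G y) \<and>
        (\<forall>i\<in>{1..n}. 2 \<le> (if i \<le> r then q i div 2 + 1 else (q i + 1) div 2))) \<or>
      (\<forall>i\<in>{1..n}. \<forall>v\<in>pverts (H i). 2 \<le> 2 * card ((if i \<le> r
        then (\<lambda>t. min (2 * t) (q i - 1)) ` {..q i div 2} else (\<lambda>t. 2 * t) ` {..<(q i + 1) div 2}) \<inter>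
        closed_nbhd (H i) v))"
      using twin by blast
  qed (rule degree)
  \<comment> \<open>For \<open>k = 3\<close> the value 4 yields both
    \<open>k + 4 \<le> 2 * a i\<close> and \<open>k \<le> a i\<close>.\<close>
  have large: "4 \<le> (if i \<le> r then q i - (q i - 4) div 5 else q i - q i div 5)" if "i \<in> {1..n}" for i
  proof (cases "i \<le> r")
    case True
    have "4 \<le> m - d" if "d \<le> m - 4" "4 \<le> m" for m d :: nat
      using that by arith
    moreover have "4 \<le> q i"
      using True q[OF that] by blast
    ultimately have "4 \<le> q i - (q i - 4) div 5"
      using div_le_dividend by blast
    with True show ?thesis
      by (simp only: if_True)
  next
    case False
    have "4 \<le> m - d" if "5 * d \<le> m" "5 \<le> m" for m d :: nat
      using that by arith
    moreover have "5 \<le> q i"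
      using False q[OF that] by blast
    ultimately have "4 \<le> q i - q i div 5"
      using times_div_less_eq_dividend by blast
    with False show ?thesis
      by (simp only: if_False)
  qed
  have dim3: "metric_dim 3 L = (\<Sum>i=1..n. if i \<le> r then q i - (q i - 4) div 5 else q i - q i div 5)"
  proof (rule metric_dim_eq_sum_card[where A = "\<lambda>i. if i \<le> r
      then {0..<q i} - (\<lambda>t. 4 + 5 * t) ` {..<(q i - 4) div 5}
      else {0..<q i} - (\<lambda>t. 5 * t) ` {..<q i div 5}"])
    fix i assume i: "i \<in> {1..n}"
    show "adjacency_generator 3 (H i) (if i \<le> r
      then {0..<q i} - (\<lambda>t. 4 + 5 * t) ` {..<(q i - 4) div 5}
      else {0..<q i} - (\<lambda>t. 5 * t) ` {..<q i div 5})"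
      using q[OF i] adjacency_3_generator_path[of "q i"] adjacency_3_generator_cycle[of "q i"]
      by (elim disjE conjE) (simp_all only: if_True if_False)
    show "card (if i \<le> r then {0..<q i} - (\<lambda>t. 4 + 5 * t) ` {..<(q i - 4) div 5}
        else {0..<q i} - (\<lambda>t. 5 * t) ` {..<q i div 5}) =
        (if i \<le> r then q i - (q i - 4) div 5 else q i - q i div 5)"
      by (cases "i \<le> r")
        (simp_all only: if_True if_False card_adjacency_3_generator_path card_adjacency_3_generator_cycle)
    show "(if i \<le> r then q i - (q i - 4) div 5 else q i - q i div 5) \<le> card B"
      if "adjacency_generator 3 (H i) B" for B
      using q[OF i] that adjacency_3_generator_path_lower[of "q i" B]
        adjacency_3_generator_cycle_lower[of "q i" B]
      by (elim disjE conjE) (simp_all only: if_True if_False)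
    show "3 + 4 \<le> 2 * (if i \<le> r then q i - (q i - 4) div 5 else q i - q i div 5)"
      using large[OF i] by linarith
  next
    have "3 \<le> (if i \<le> r then q i - (q i - 4) div 5 else q i - q i div 5)" if "i \<in> {1..n}" for i
      using large[OF that] by linarith
    then show "((\<forall>x\<in>pverts G. \<forall>y\<in>pverts G. x \<noteq> y \<longrightarrow> closed_nbhd G x \<noteq> closed_nbhd G y) \<and>
        (\<forall>i\<in>{1..n}. 3 \<le> (if i \<le> r then q i - (q i - 4) div 5 else q i - q i div 5))) \<or>
      (\<forall>i\<in>{1..n}. \<forall>v\<in>pverts (H i). 3 \<le> 2 * card ((if i \<le> r
        then {0..<q i} - (\<lambda>t. 4 + 5 * t) ` {..<(q i - 4) div 5}
        else {0..<q i} - (\<lambda>t. 5 * t) ` {..<q i div 5}) \<inter> closed_nbhd (H i) v))"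
      using twin by blast
  qed (rule degree)
  have "int (metric_dim 2 L) =
      (\<Sum>i=1..r. \<lceil>(real (q i) + 1) / 2\<rceil>) + (\<Sum>i=r+1..n. \<lceil>real (q i) / 2\<rceil>)"
    unfolding dim2
  proof (rule int_sum_split[OF r])
    fix i
    show "int (q i div 2 + 1) = \<lceil>(real (q i) + 1) / 2\<rceil>"
      using ceiling_half[of "q i + 1"] by (simp add: add.commute)
    show "int ((q i + 1) div 2) = \<lceil>real (q i) / 2\<rceil>"
      by (simp only: ceiling_half)
  qed
  moreover have "int (metric_dim 3 L) =
      (\<Sum>i=1..r. int (q i) - \<lfloor>(real (q i) - 4) / 5\<rfloor>) +
      (\<Sum>i=r+1..n. int (q i) - \<lfloor>real (q i) / 5\<rfloor>)"
    unfolding dim3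
  proof (rule int_sum_split[OF r])
    fix i
    show "int (q i - q i div 5) = int (q i) - \<lfloor>real (q i) / 5\<rfloor>"
      by (simp add: floor_div_5 of_nat_diff)
    assume "i \<in> {1..r}"
    then have "4 \<le> q i"
      using hyps by blast
    \<comment> \<open>Because \<open>4 \<le> q i\<close>, the truncated difference
      \<open>q i - 4\<close> agrees with the real one.\<close>
    then show "int (q i - (q i - 4) div 5) = int (q i) - \<lfloor>(real (q i) - 4) / 5\<rfloor>"
      using floor_div_5[of "q i - 4"] div_le_dividend[of "q i - 4" 5] by (simp add: of_nat_diff)
  qed
  ultimately show "let H = (\<lambda>i. if i \<le> r then path_graph (q i) else cycle_graph (q i));
           GH = lex_product G n u (\<lambda>i. complement_graph (H i))
       in int (metric_dim 2 GH) =
            (\<Sum>i=1..r. \<lceil>(real (q i) + 1) / 2\<rceil>) + (\<Sum>i=r+1..n. \<lceil>real (q i) / 2\<rceil>) \<and>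
          int (metric_dim 3 GH) =
            (\<Sum>i=1..r. int (q i) - \<lfloor>(real (q i) - 4) / 5\<rfloor>) +
            (\<Sum>i=r+1..n. int (q i) - \<lfloor>real (q i) / 5\<rfloor>)"
    unfolding Let_def H_def[symmetric] L by (rule conjI)
next
  assume q: "\<forall>i\<in>{1..n}. q i \<ge> 5"
  define H where "H = (\<lambda>i. cycle_graph (q i))"
  interpret lex_complement G n u H
  proof (rule lex_complement.intro[OF assms])
    fix i assume "i \<in> {1..n}"
    then have "5 \<le> q i"
      using q by blast
    then show "finite (pverts (H i))" "pverts (H i) \<noteq> {}"
      by (simp_all add: H_def)
  qed
  have "metric_dim 4 L = (\<Sum>i=1..n. q i)"
  proof (rule metric_dim_eq_sum_card[where A = "\<lambda>i. {0..<q i}"])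
    fix i assume "i \<in> {1..n}"
    then have "5 \<le> q i"
      using q by blast
    then show "adjacency_generator 4 (H i) {0..<q i}" "4 + 4 \<le> 2 * q i"
      by (simp_all add: H_def adjacency_4_generator_cycle)
    show "q i \<le> card B" if "adjacency_generator 4 (H i) B" for B
      using that \<open>5 \<le> q i\<close> by (simp add: H_def adjacency_4_generator_cycle_lower)
    show "\<exists>a b. {z. (v, z) \<in> parcs (H i)} \<subseteq> {a, b}" for v
      unfolding H_def by (rule neighbours_cycle)
  next
    \<comment> \<open>\<open>G\<close> may have twins here, so the closed-neighbourhood alternative
      of \<open>near\<close> is the one to establish.\<close>
    have "4 \<le> 2 * card ({0..<q i} \<inter> closed_nbhd (H i) v)" if "i \<in> {1..n}" "v \<in> pverts (H i)" for i v
    proof -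
      have "5 \<le> q i" "v < q i"
        using q that by (auto simp: H_def)
      then show ?thesis
        using two_le_card_closed_nbhd_cycle[of "q i" v] by (simp add: H_def)
    qed
    then show "((\<forall>x\<in>pverts G. \<forall>y\<in>pverts G. x \<noteq> y \<longrightarrow> closed_nbhd G x \<noteq> closed_nbhd G y) \<and>
        (\<forall>i\<in>{1..n}. 4 \<le> q i)) \<or>
      (\<forall>i\<in>{1..n}. \<forall>v\<in>pverts (H i). 4 \<le> 2 * card ({0..<q i} \<inter> closed_nbhd (H i) v))"
      by blast
  qed simp
  then show "metric_dim 4 (lex_product G n u (\<lambda>i. complement_graph (cycle_graph (q i)))) = (\<Sum>i=1..n. q i)"
    unfolding L_def unfolding H_def .
qed

end
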